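(* Let $a,b\in\mathbb{R}$, $2\psi\in(0,\pi)$, $\nu>0$, $\alpha,\lambda\in\mathbb{R}$, and let $\phi\in[-\pi,\pi]$ be fixed. Let the kernel satisfy $\varphi\in H^{\lambda,\infty}(\mathbb{R}^2)$ and let $f\in H^{\alpha,2}(\mathbb{R}^2)$. Then $\widetilde{\mathcal{V}_L}f(\cdot,\phi)\in H^{\alpha+\lambda,2}(\mathbb{R}^2)$.
   Context: Fourier transform: $\hat f(\xi)=\int e^{-i\mathbf{x}\cdot\xi}f(\mathbf{x})\,d\mathbf{x}$. For $\alpha\in\mathbb{R}$, $1\le p\le\infty$, $H^{\alpha,p}(\mathbb{R}^n)$ is the space of tempered distributions $f$ whose Fourier transform is a measurable function with $\|f\|_{H^{\alpha,p}(\mathbb{R}^n)}=\|(1+|\xi|^2)^{\alpha/2}\hat f\|_{L^p(\mathbb{R}^n)}<\infty$. The finite-length V-line transform is $$\mathcal{V}_Lf(\mathbf{x},\phi)=a\int_0^\nu f(\mathbf{x}+t\Phi)\,dt+b\int_0^\nu f(\mathbf{x}+t\Phi')\,dt,$$ where $\Phi=(\cos(\phi+2\psi-\pi/2),\sin(\phi+2\psi-\pi/2))$ and $\Phi'=(\cos(\phi-\pi/2),\sin(\phi-\pi/2))$. Its smoothed version is $\widetilde{\mathcal{V}_L}f(\cdot,\phi)=\varphi*\mathcal{V}_Lf(\cdot,\phi)$ (convolution in $\mathbf{x}$), where $\varphi\ge 0$ is a smoothing kernel with $\int_{\mathbb{R}^2}\varphi=1$. For fixed $\phi$ its Fourier transform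 in $\mathbf{x}$ is $\hat\varphi(\xi)\hat f(\xi)\,(a\,m(\xi\cdot\Phi)+b\,m(\xi\cdot\Phi'))$ with $m(y)=\int_0^\nu e^{ity}\,dt$; this is its meaning when $f$ is only a tempered distribution with $\hat f$ a function. *)

theory Defs
  imports "HOL-Analysis.Analysis" "HOL-Probability.Essential_Supremum"
begin

section \<open>Schwartz functions and tempered distributions\<close>

definition partial_deriv :: "'a \<Rightarrow> ('a::euclidean_space \<Rightarrow> complex) \<Rightarrow> 'a \<Rightarrow> complex" where
  "partial_deriv b g = (\<lambda>x. frechet_derivative g (at x) b)"

text \<open>A multi-index is encoded as a list of basis vectors.\<close>

definition schwartz_weighted ::
    "nat \<Rightarrow> 'a list \<Rightarrow> ('a::euclidean_space \<Rightarrow> complex) \<Rightarrow> 'a \<Rightarrow> real" where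
  "schwartz_weighted k bs g x = (1 + norm x) ^ k * norm (foldr partial_deriv bs g x)"

text \<open>Total differentiability of all iterated partial derivatives is smoothness: it makes each of
  them continuous.\<close>

definition schwartz_space :: "('a::euclidean_space \<Rightarrow> complex) set" where
  "schwartz_space = {g. \<forall>bs\<in>lists Basis. foldr partial_deriv bs g differentiable_on UNIV \<and>
     (\<forall>k. bdd_above (range (schwartz_weighted k bs g)))}"

definition schwartz_seminorm ::
    "nat \<Rightarrow> 'a list \<Rightarrow> ('a::euclidean_space \<Rightarrow> complex) \<Rightarrow> real" where
  "schwartz_seminorm k bs g = (SUP x. schwartz_weighted k bs g x)"

text \<open>Distributions are functionals that are undefined off the Schwartz space, so that equality of
  functionals is equality of distributions. The last condition is continuity for the topology given
  by the seminorms.\<close>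

definition tempered_distributions ::
    "(('a::euclidean_space \<Rightarrow> complex) \<Rightarrow> complex) set" where
  "tempered_distributions = {T \<in> extensional schwartz_space.
     (\<forall>g\<in>schwartz_space. \<forall>h\<in>schwartz_space. T (\<lambda>x. g x + h x) = T g + T h) \<and>
     (\<forall>c. \<forall>g\<in>schwartz_space. T (\<lambda>x. c * g x) = c * T g) \<and>
     (\<exists>N C. \<forall>g\<in>schwartz_space. norm (T g) \<le>
        C * (\<Sum>bs | bs \<in> lists Basis \<and> length bs \<le> N. schwartz_seminorm N bs g))}"

definition fun_dist ::
    "('a::euclidean_space \<Rightarrow> complex) \<Rightarrow> ('a \<Rightarrow> complex) \<Rightarrow> complex" where
  "fun_dist F = (\<lambda>g\<in>schwartz_space. \<integral>x. F x * g x \<partial>lborel)"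

section \<open>Fourier transform\<close>

definition fourier :: "('a::euclidean_space \<Rightarrow> complex) \<Rightarrow> 'a \<Rightarrow> complex" where
  "fourier f \<xi> = (\<integral>x. exp (- (\<i> * complex_of_real (x \<bullet> \<xi>))) * f x \<partial>lborel)"

definition dist_fourier ::
    "(('a::euclidean_space \<Rightarrow> complex) \<Rightarrow> complex) \<Rightarrow> ('a \<Rightarrow> complex) \<Rightarrow> complex" where
  "dist_fourier T = (\<lambda>g\<in>schwartz_space. T (fourier g))"

definition has_fourier_fun ::
    "(('a::euclidean_space \<Rightarrow> complex) \<Rightarrow> complex) \<Rightarrow> ('a \<Rightarrow> complex) \<Rightarrow> bool" where
  "has_fourier_fun T F \<longleftrightarrow> F \<in> borel_measurable lborel \<and>
     (\<forall>g\<in>schwartz_space. integrable lborel (\<lambda>\<xi>. F \<xi> * g \<xi>)) \<and>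
     dist_fourier T = fun_dist F"

text \<open>The representing function is unique up to null sets; this picks a representative.\<close>

definition fourier_fun ::
    "(('a::euclidean_space \<Rightarrow> complex) \<Rightarrow> complex) \<Rightarrow> 'a \<Rightarrow> complex" where
  "fourier_fun T = (SOME F. has_fourier_fun T F)"

section \<open>Sobolev spaces\<close>

definition Lp_norm :: "ennreal \<Rightarrow> ('a::euclidean_space \<Rightarrow> complex) \<Rightarrow> ennreal" where
  "Lp_norm p F =
     (if p = \<infinity> then esssup lborel (\<lambda>x. ennreal (norm (F x)))
      else let I = (\<integral>\<^sup>+x. ennreal (norm (F x) powr enn2real p) \<partial>lborel) in
        if I = \<infinity> then \<infinity> else ennreal (enn2real I powr (1 / enn2real p)))"

definition sobolev_norm ::
    "real \<Rightarrow> ennreal \<Rightarrow> (('a::euclidean_space \<Rightarrow> complex) \<Rightarrow> complex) \<Rightarrow> ennreal" where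
  "sobolev_norm \<alpha> p T =
     Lp_norm p (\<lambda>\<xi>. complex_of_real ((1 + (norm \<xi>)\<^sup>2) powr (\<alpha> / 2)) * fourier_fun T \<xi>)"

definition sobolev_space ::
    "real \<Rightarrow> ennreal \<Rightarrow> (('a::euclidean_space \<Rightarrow> complex) \<Rightarrow> complex) set" where
  "sobolev_space \<alpha> p =
     {T \<in> tempered_distributions. (\<exists>F. has_fourier_fun T F) \<and> sobolev_norm \<alpha> p T < \<infinity>}"

section \<open>The V-line transform of finite length\<close>

definition dir1 :: "real \<Rightarrow> real \<Rightarrow> real^2" where
  "dir1 \<psi> \<phi> = vector [cos (\<phi> + 2 * \<psi> - pi / 2), sin (\<phi> + 2 * \<psi> - pi / 2)]"

definition dir2 :: "real \<Rightarrow> real^2" where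
  "dir2 \<phi> = vector [cos (\<phi> - pi / 2), sin (\<phi> - pi / 2)]"

definition vline ::
    "real \<Rightarrow> real \<Rightarrow> real \<Rightarrow> real \<Rightarrow> (real^2 \<Rightarrow> complex) \<Rightarrow> real^2 \<Rightarrow> real \<Rightarrow> complex" where
  "vline a b \<psi> \<nu> f x \<phi> =
     complex_of_real a * (LBINT t:{0..\<nu>}. f (x + t *\<^sub>R dir1 \<psi> \<phi>)) +
     complex_of_real b * (LBINT t:{0..\<nu>}. f (x + t *\<^sub>R dir2 \<phi>))"

definition segment_symbol :: "real \<Rightarrow> real \<Rightarrow> complex" where
  "segment_symbol \<nu> y = (LBINT t:{0..\<nu>}. exp (\<i> * complex_of_real (t * y)))"

definition vline_symbol ::
    "real \<Rightarrow> real \<Rightarrow> real \<Rightarrow> real \<Rightarrow> real \<Rightarrow> real^2 \<Rightarrow> complex" where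
  "vline_symbol a b \<psi> \<nu> \<phi> \<xi> =
     complex_of_real a * segment_symbol \<nu> (\<xi> \<bullet> dir1 \<psi> \<phi>) +
     complex_of_real b * segment_symbol \<nu> (\<xi> \<bullet> dir2 \<phi>)"

text \<open>The smoothed transform of a distribution \<open>f\<close>, at the angle \<open>\<phi>\<close> and with the kernel \<open>\<eta>\<close>. For
  integrable functions \<open>f\<close> the formula is the Fourier transform of the convolution of \<open>\<eta>\<close> with
  \<open>vline a b \<psi> \<nu> f\<close>, see \<open>fourier_convolution_vline\<close> below.\<close>

definition smoothed_vline ::
    "real \<Rightarrow> real \<Rightarrow> real \<Rightarrow> real \<Rightarrow> (real^2 \<Rightarrow> real) \<Rightarrow> ((real^2 \<Rightarrow> complex) \<Rightarrow> complex) \<Rightarrow> real \<Rightarrow>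
     (real^2 \<Rightarrow> complex) \<Rightarrow> complex" where
  "smoothed_vline a b \<psi> \<nu> \<eta> f \<phi> = (THE W. W \<in> tempered_distributions \<and>
     has_fourier_fun W (\<lambda>\<xi>. fourier (\<lambda>x. complex_of_real (\<eta> x)) \<xi> * fourier_fun f \<xi> *
       vline_symbol a b \<psi> \<nu> \<phi> \<xi>))"

section \<open>Agreement with the pointwise definition\<close>

lemma lborel_translate:
  fixes f :: "'a::euclidean_space \<Rightarrow> 'b::{banach, second_countable_topology}"
  assumes f: "integrable lborel f"
  shows "integrable lborel (\<lambda>x. f (x + v))"
    and "(\<integral>x. f (x + v) \<partial>lborel) = (\<integral>x. f x \<partial>lborel)"
proof -
  have m: "(+) v \<in> measurable lborel borel" by simp
  have f': "f \<in> borel_measurable borel" using f by auto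
  have d: "distr lborel borel ((+) v) = lborel" by (rule lborel_distr_plus)
  have "integrable (distr lborel borel ((+) v)) f" using f by (simp add: d)
  then show "integrable lborel (\<lambda>x. f (x + v))"
    using integrable_distr_eq[OF m f'] by (simp add: add.commute)
  show "(\<integral>x. f (x + v) \<partial>lborel) = (\<integral>x. f x \<partial>lborel)"
    using integral_distr[OF m f'] by (simp add: d add.commute)
qed

lemma fourier_translate:
  assumes f: "integrable lborel f"
  shows "fourier (\<lambda>x. f (x + v)) \<xi> = exp (\<i> * complex_of_real (v \<bullet> \<xi>)) * fourier f \<xi>"
proof -
  let ?h = "\<lambda>x. exp (- (\<i> * complex_of_real (x \<bullet> \<xi>))) * f x"
  have f': "f \<in> borel_measurable borel" using f by auto
  have "integrable lborel ?h"
    by (rule Bochner_Integration.integrable_bound[OF f]) (use f' in \<open>auto simp: norm_mult\<close>)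
  from lborel_translate(2)[OF this, of v]
  have e: "(\<integral>x. exp (- (\<i> * complex_of_real ((x + v) \<bullet> \<xi>))) * f (x + v) \<partial>lborel) = fourier f \<xi>"
    by (simp add: fourier_def)
  have "fourier (\<lambda>x. f (x + v)) \<xi> = (\<integral>x. exp (\<i> * complex_of_real (v \<bullet> \<xi>)) *
      (exp (- (\<i> * complex_of_real ((x + v) \<bullet> \<xi>))) * f (x + v)) \<partial>lborel)"
    unfolding fourier_def
    by (intro Bochner_Integration.integral_cong refl)
       (simp add: inner_add_left ring_distribs exp_add[symmetric] mult.assoc[symmetric])
  also have "\<dots> = exp (\<i> * complex_of_real (v \<bullet> \<xi>)) * fourier f \<xi>"
    by (simp add: e)
  finally show ?thesis .
qed

lemma fourier_superposition:
  fixes w :: "'b::euclidean_space \<Rightarrow> complex" and u :: "'b \<Rightarrow> 'a::euclidean_space"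
  assumes w: "integrable lborel w" and u[measurable]: "u \<in> borel_measurable borel"
    and f: "integrable lborel f"
  shows "integrable lborel (\<lambda>x. \<integral>s. w s * f (x + u s) \<partial>lborel)" (is ?A)
    and "fourier (\<lambda>x. \<integral>s. w s * f (x + u s) \<partial>lborel) \<xi> =
      (\<integral>s. w s * exp (\<i> * complex_of_real (u s \<bullet> \<xi>)) \<partial>lborel) * fourier f \<xi>" (is ?B)
proof -
  have [measurable]: "f \<in> borel_measurable borel" "w \<in> borel_measurable borel"
    using f w by auto
  let ?G = "\<lambda>(s, x). w s * f (x + u s)"
  let ?e = "\<lambda>x. exp (- (\<i> * complex_of_real (x \<bullet> \<xi>)))"
  have G: "integrable (lborel \<Otimes>\<^sub>M lborel) ?G"
  proof (rule lborel_pair.Fubini_integrable)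
    have "(\<integral>x. norm (f (x + u s)) \<partial>lborel) = (\<integral>x. norm (f x) \<partial>lborel)" for s
      using lborel_translate(2)[OF integrable_norm[OF f], of "u s"] .
    then show "integrable lborel (\<lambda>s. \<integral>x. norm (?G (s, x)) \<partial>lborel)"
      using w by (simp add: norm_mult)
    show "AE s in lborel. integrable lborel (\<lambda>x. ?G (s, x))"
      using lborel_translate(1)[OF f] by simp
  qed measurable
  show ?A using lborel_pair.integrable_snd[OF G] by simp
  have E: "integrable (lborel \<Otimes>\<^sub>M lborel) (\<lambda>(s, x). ?e x * (w s * f (x + u s)))"
    by (rule Bochner_Integration.integrable_bound[OF G]) (auto simp: norm_mult split_beta')
  have "fourier (\<lambda>x. \<integral>s. w s * f (x + u s) \<partial>lborel) \<xi> =
      (\<integral>x. (\<integral>s. ?e x * (w s * f (x + u s)) \<partial>lborel) \<partial>lborel)"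
    by (simp add: fourier_def)
  also have "\<dots> = (\<integral>s. (\<integral>x. ?e x * (w s * f (x + u s)) \<partial>lborel) \<partial>lborel)"
    by (rule lborel_pair.Fubini_integral[OF E])
  also have "\<dots> = (\<integral>s. w s * fourier (\<lambda>x. f (x + u s)) \<xi> \<partial>lborel)"
    unfolding fourier_def by (simp add: mult.left_commute)
  also have "\<dots> = (\<integral>s. (w s * exp (\<i> * complex_of_real (u s \<bullet> \<xi>))) * fourier f \<xi> \<partial>lborel)"
    by (simp add: fourier_translate[OF f] mult.assoc)
  also have "\<dots> = (\<integral>s. w s * exp (\<i> * complex_of_real (u s \<bullet> \<xi>)) \<partial>lborel) * fourier f \<xi>"
    by simp
  finally show ?B .
qed

lemma fourier_ray:
  fixes f :: "'a::euclidean_space \<Rightarrow> complex"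
  assumes f: "integrable lborel f"
  shows "integrable lborel (\<lambda>x. LBINT t:{0..\<nu>}. f (x + t *\<^sub>R v))"
    and "fourier (\<lambda>x. LBINT t:{0..\<nu>}. f (x + t *\<^sub>R v)) \<xi> =
      segment_symbol \<nu> (\<xi> \<bullet> v) * fourier f \<xi>"
proof -
  let ?w = "\<lambda>t::real. complex_of_real (indicator {0..\<nu>} t)"
  have w: "integrable lborel ?w" by (intro integrable_of_real integrable_real_indicator) (auto simp: emeasure_lborel_Icc_eq)
  have u: "(\<lambda>t::real. t *\<^sub>R v) \<in> borel_measurable borel" by simp
  note S = fourier_superposition[OF w u f]
  show "integrable lborel (\<lambda>x. LBINT t:{0..\<nu>}. f (x + t *\<^sub>R v))"
    using S(1) by (simp add: set_lebesgue_integral_def scaleR_conv_of_real)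
  show "fourier (\<lambda>x. LBINT t:{0..\<nu>}. f (x + t *\<^sub>R v)) \<xi> =
      segment_symbol \<nu> (\<xi> \<bullet> v) * fourier f \<xi>"
    using S(2)[of \<xi>]
    by (simp add: set_lebesgue_integral_def scaleR_conv_of_real segment_symbol_def inner_commute)
qed

lemma fourier_vline:
  assumes f: "integrable lborel f"
  shows "integrable lborel (\<lambda>x. vline a b \<psi> \<nu> f x \<phi>)"
    and "fourier (\<lambda>x. vline a b \<psi> \<nu> f x \<phi>) \<xi> = fourier f \<xi> * vline_symbol a b \<psi> \<nu> \<phi> \<xi>"
proof -
  let ?e = "\<lambda>x. exp (- (\<i> * complex_of_real (x \<bullet> \<xi>)))"
  have e: "integrable lborel (\<lambda>x. ?e x * g x)" if "integrable lborel g" for g :: "real^2 \<Rightarrow> complex"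
  proof -
    have "g \<in> borel_measurable borel" using that by auto
    then show ?thesis
      by (intro Bochner_Integration.integrable_bound[OF that]) (auto simp: norm_mult)
  qed
  note R = fourier_ray(1)[OF f, of \<nu>]
  show "integrable lborel (\<lambda>x. vline a b \<psi> \<nu> f x \<phi>)"
    unfolding vline_def using R by simp
  have "fourier (\<lambda>x. vline a b \<psi> \<nu> f x \<phi>) \<xi> =
      complex_of_real a * fourier (\<lambda>x. LBINT t:{0..\<nu>}. f (x + t *\<^sub>R dir1 \<psi> \<phi>)) \<xi> +
      complex_of_real b * fourier (\<lambda>x. LBINT t:{0..\<nu>}. f (x + t *\<^sub>R dir2 \<phi>)) \<xi>"
    unfolding fourier_def vline_def
    by (simp add: ring_distribs mult.left_commute e[OF R])
  then show "fourier (\<lambda>x. vline a b \<psi> \<nu> f x \<phi>) \<xi> = fourier f \<xi> * vline_symbol a b \<psi> \<nu> \<phi> \<xi>"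
    by (simp add: fourier_ray(2)[OF f] vline_symbol_def algebra_simps)
qed

lemma fourier_convolution_vline:
  fixes \<eta> :: "real^2 \<Rightarrow> real"
  assumes \<eta>: "integrable lborel \<eta>" and f: "integrable lborel f"
  shows "fourier (\<lambda>x. \<integral>y. complex_of_real (\<eta> y) * vline a b \<psi> \<nu> f (x - y) \<phi> \<partial>lborel) \<xi> =
    fourier (\<lambda>x. complex_of_real (\<eta> x)) \<xi> * fourier f \<xi> * vline_symbol a b \<psi> \<nu> \<phi> \<xi>"
proof -
  have w: "integrable lborel (\<lambda>y. complex_of_real (\<eta> y))" using \<eta> by simp
  have u: "(\<lambda>y::real^2. - y) \<in> borel_measurable borel" by simp
  show ?thesis
    using fourier_superposition(2)[OF w u fourier_vline(1)[OF f], of a b \<psi> \<nu> \<phi> \<xi>]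
    by (simp add: fourier_vline(2)[OF f] fourier_def[of "\<lambda>x. complex_of_real (\<eta> x)"] mult.commute
        mult.assoc)
qed

end

theory Submission
  imports Defs "HOL-Probability.Characteristic_Functions" "HOL-Probability.Sinc_Integral"
begin

text \<open>On the Fourier side the smoothed transform multiplies by the Fourier transform of the kernel,
  which is \<open>O((1 + |\<xi>|\<^sup>2) powr (- \<beta> / 2))\<close>, and by the symbol of the V-line transform, which is
  bounded by \<open>(|a| + |b|) \<nu>\<close>; this gives the norm estimate. What remains is that the product is the
  Fourier transform of exactly one tempered distribution, and that a distribution determines the
  function representing its Fourier transform almost everywhere. The former rests on Fourier inversion
  and on the continuity of the Fourier transform on the Schwartz space, the latter on testing against
  Gaussians.\<close>

section \<open>Functions in the Schwartz space\<close>

text \<open>The obstacle is the handling of representatives. \<open>smoothed_vline\<close> is a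
  definite description, so nothing can be said of it before existence and uniqueness are known; and
  \<open>sobolev_norm\<close> evaluates \<open>fourier_fun\<close>, an arbitrary choice among
  functions that agree only almost everywhere. Uniqueness almost everywhere is therefore used twice:
  to carry the hypothesis on the kernel over to its pointwise transform \<open>fourier\<close>, and
  to carry the estimate for the product over to the representative chosen for the result. A function
  representing a Fourier transform is only known to be integrable against Schwartz functions.
  Multiplying it by a Gaussian makes it integrable, and products of Gaussians are again exponentials
  of quadratics. Since a Gaussian is also a multiple of its own transform, this one family serves
  both inversion and uniqueness, in place of smooth functions of compact support.\<close>

lemma partial_deriv_eq:
  assumes "(f has_derivative D) (at x)"
  shows "partial_deriv b f x = D b"
  using frechet_derivative_at[OF assms] by (simp add: partial_deriv_def)

lemma has_derivative_partial:
  assumes "f differentiable_on UNIV"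
  shows "(f has_derivative (\<lambda>h. frechet_derivative f (at x) h)) (at x)"
  using assms frechet_derivative_works[of f "at x"] by (auto simp: differentiable_on_def)

text \<open>Built for coinduction: by the product rule, a partial derivative of a coordinate times
  \<open>g\<close> is a coordinate multiple plus a scalar multiple, so these closure operations keep
  the set stable under derivatives as soon as the derivatives of the generators lie in it.\<close>

inductive_set schwartz_span :: "('a::euclidean_space \<Rightarrow> complex) set \<Rightarrow> ('a \<Rightarrow> complex) set"
  for X where
  base: "g \<in> X \<Longrightarrow> g \<in> schwartz_span X"
| add: "g \<in> schwartz_span X \<Longrightarrow> h \<in> schwartz_span X \<Longrightarrow> (\<lambda>x. g x + h x) \<in> schwartz_span X"
| cmult: "g \<in> schwartz_span X \<Longrightarrow> (\<lambda>x. c * g x) \<in> schwartz_span X"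
| coord: "g \<in> schwartz_span X \<Longrightarrow> (\<lambda>x. complex_of_real (x \<bullet> v) * g x) \<in> schwartz_span X"

definition rapidly_decreasing :: "('a::euclidean_space \<Rightarrow> complex) \<Rightarrow> bool" where
  "rapidly_decreasing g \<longleftrightarrow> (\<forall>k. \<exists>C. \<forall>x. (1 + norm x) ^ k * norm (g x) \<le> C)"

lemma rapidly_decreasing_add:
  assumes "rapidly_decreasing g" "rapidly_decreasing h"
  shows "rapidly_decreasing (\<lambda>x. g x + h x)"
  unfolding rapidly_decreasing_def
proof
  fix k
  obtain C D where C: "\<And>x. (1 + norm x) ^ k * norm (g x) \<le> C"
    and D: "\<And>x. (1 + norm x) ^ k * norm (h x) \<le> D"
    using assms unfolding rapidly_decreasing_def by blast
  have "(1 + norm x) ^ k * norm (g x + h x) \<le> C + D" for x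
  proof -
    have "(1 + norm x) ^ k * norm (g x + h x) \<le> (1 + norm x) ^ k * (norm (g x) + norm (h x))"
      by (intro mult_left_mono norm_triangle_ineq) auto
    also have "\<dots> \<le> C + D" using C[of x] D[of x] by (simp add: distrib_left)
    finally show ?thesis .
  qed
  then show "\<exists>C. \<forall>x. (1 + norm x) ^ k * norm (g x + h x) \<le> C" by blast
qed

lemma rapidly_decreasing_mult:
  assumes "rapidly_decreasing g" and p: "\<And>x. norm (p x) \<le> B * (1 + norm x) ^ m"
  shows "rapidly_decreasing (\<lambda>x. p x * g x)"
  unfolding rapidly_decreasing_def
proof
  fix k
  obtain C where C: "\<And>x. (1 + norm x) ^ (k + m) * norm (g x) \<le> C"
    using assms unfolding rapidly_decreasing_def by blast
  have B: "0 \<le> B" using p[of 0] by (auto intro: order_trans[OF norm_ge_zero])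
  have "(1 + norm x) ^ k * norm (p x * g x) \<le> B * C" for x
  proof -
    have "(1 + norm x) ^ k * norm (p x * g x) \<le> (1 + norm x) ^ k * ((B * (1 + norm x) ^ m) * norm (g x))"
      unfolding norm_mult by (intro mult_left_mono mult_right_mono p) auto
    also have "\<dots> = B * ((1 + norm x) ^ (k + m) * norm (g x))" by (simp add: power_add)
    also have "\<dots> \<le> B * C" by (intro mult_left_mono C B)
    finally show ?thesis .
  qed
  then show "\<exists>C. \<forall>x. (1 + norm x) ^ k * norm (p x * g x) \<le> C" by blast
qed

lemma schwartz_spaceD:
  assumes "g \<in> schwartz_space"
  shows "g differentiable_on UNIV" "rapidly_decreasing g"
    "b \<in> Basis \<Longrightarrow> partial_deriv b g \<in> schwartz_space"
proof -
  have *: "foldr partial_deriv bs g differentiable_on UNIV"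
      "bdd_above (range (schwartz_weighted k bs g))" if "bs \<in> lists Basis" for bs k
    using assms that by (auto simp: schwartz_space_def)
  show "g differentiable_on UNIV" using *(1)[of "[]"] by simp
  show "rapidly_decreasing g"
    using *(2)[of "[]"] by (auto simp: rapidly_decreasing_def bdd_above_def schwartz_weighted_def)
  show "partial_deriv b g \<in> schwartz_space" if "b \<in> Basis"
    using *[of "_ @ [b]"] that by (auto simp: schwartz_space_def schwartz_weighted_def[abs_def])
qed

text \<open>The Schwartz space is the largest set of differentiable, rapidly decreasing functions that is
  closed under partial derivatives; membership is therefore proved by coinduction.\<close>

lemma schwartz_space_coinduct:
  assumes "g \<in> A"
    and "\<And>g. g \<in> A \<Longrightarrow> g differentiable_on UNIV"
    and "\<And>g. g \<in> A \<Longrightarrow> rapidly_decreasing g"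
    and "\<And>g b. g \<in> A \<Longrightarrow> b \<in> Basis \<Longrightarrow> partial_deriv b g \<in> A"
  shows "g \<in> schwartz_space"
proof -
  have A: "foldr partial_deriv bs g \<in> A" if "bs \<in> lists Basis" for bs
    using that by (induction bs) (auto intro: assms)
  show ?thesis
    unfolding schwartz_space_def
    using assms(2)[OF A] assms(3)[OF A]
    by (auto simp: schwartz_weighted_def bdd_above_def rapidly_decreasing_def)
qed

text \<open>The sum and product rules leave the span invariant under derivatives, so it can serve as
  the set in the coinduction and only the generators have to be examined. It is used with the whole
  Schwartz space as generators, for the closure properties, and with a single exponential of a
  quadratic.\<close>

lemma schwartz_span_subset:
  assumes diff: "\<And>g. g \<in> X \<Longrightarrow> g differentiable_on UNIV"
    and decr: "\<And>g. g \<in> X \<Longrightarrow> rapidly_decreasing g"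
    and part: "\<And>g b. g \<in> X \<Longrightarrow> b \<in> Basis \<Longrightarrow> partial_deriv b g \<in> schwartz_span X"
  shows "schwartz_span X \<subseteq> schwartz_space"
proof
  have d: "g differentiable_on UNIV" if "g \<in> schwartz_span X" for g
    using that
  proof induction
    case (coord g v)
    have "(\<lambda>x::'a. complex_of_real (x \<bullet> v)) differentiable_on UNIV"
      by (auto simp: differentiable_on_def differentiable_def intro!: exI derivative_eq_intros)
    then show ?case using coord by (auto simp: differentiable_on_def)
  qed (use diff in \<open>auto simp: differentiable_on_def\<close>)
  have r: "rapidly_decreasing g" if "g \<in> schwartz_span X" for g
    using that
  proof induction
    case (cmult g c)
    then show ?case by (intro rapidly_decreasing_mult[where B="norm c" and m=0]) auto
  next
    case (coord g v)
    have "\<bar>x \<bullet> v\<bar> \<le> norm v * (1 + norm x) ^ 1" for x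
    proof -
      have "\<bar>x \<bullet> v\<bar> \<le> norm x * norm v" by (rule Cauchy_Schwarz_ineq2)
      also have "\<dots> \<le> norm v * (1 + norm x) ^ 1" by (simp add: algebra_simps)
      finally show ?thesis .
    qed
    with coord show ?case by (intro rapidly_decreasing_mult[where B="norm v" and m=1]) auto
  qed (auto intro: decr rapidly_decreasing_add)
  have p: "partial_deriv b g \<in> schwartz_span X" if "g \<in> schwartz_span X" "b \<in> Basis" for g b
    using that
  proof induction
    case (base g)
    then show ?case by (simp add: part)
  next
    case (add g h)
    have "((\<lambda>x. g x + h x) has_derivative
        (\<lambda>y. frechet_derivative g (at x) y + frechet_derivative h (at x) y)) (at x)" for x
      by (intro has_derivative_add has_derivative_partial d add.hyps)
    from partial_deriv_eq[OF this]
    have "partial_deriv b (\<lambda>x. g x + h x) = (\<lambda>x. partial_deriv b g x + partial_deriv b h x)"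
      by (simp add: partial_deriv_def fun_eq_iff)
    then show ?case using add by (simp add: schwartz_span.add)
  next
    case (cmult g c)
    have "((\<lambda>x. c * g x) has_derivative (\<lambda>y. c * frechet_derivative g (at x) y)) (at x)" for x
      by (intro has_derivative_mult_right has_derivative_partial d cmult.hyps)
    from partial_deriv_eq[OF this]
    have "partial_deriv b (\<lambda>x. c * g x) = (\<lambda>x. c * partial_deriv b g x)"
      by (simp add: partial_deriv_def fun_eq_iff)
    then show ?case using cmult by (simp add: schwartz_span.cmult)
  next
    case (coord g v)
    have "((\<lambda>x. complex_of_real (x \<bullet> v) * g x) has_derivative
        (\<lambda>y. complex_of_real (x \<bullet> v) * frechet_derivative g (at x) y +
          complex_of_real (y \<bullet> v) * g x)) (at x)" for x
      by (rule has_derivative_mult)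
         (auto intro!: derivative_eq_intros has_derivative_partial d coord.hyps)
    from partial_deriv_eq[OF this]
    have "partial_deriv b (\<lambda>x. complex_of_real (x \<bullet> v) * g x) =
        (\<lambda>x. complex_of_real (x \<bullet> v) * partial_deriv b g x + complex_of_real (b \<bullet> v) * g x)"
      by (simp add: partial_deriv_def fun_eq_iff)
    then show ?case
      using coord by (simp add: schwartz_span.add schwartz_span.cmult schwartz_span.coord)
  qed
  show "g \<in> schwartz_space" if "g \<in> schwartz_span X" for g
    using that by (rule schwartz_space_coinduct) (simp_all add: d r p)
qed

lemma schwartz_span_schwartz_space: "schwartz_span schwartz_space \<subseteq> schwartz_space"
  by (rule schwartz_span_subset) (simp_all add: schwartz_spaceD schwartz_span.base)

lemma schwartz_space_add:
  "g \<in> schwartz_space \<Longrightarrow> h \<in> schwartz_space \<Longrightarrow> (\<lambda>x. g x + h x) \<in> schwartz_space"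
  by (rule subsetD[OF schwartz_span_schwartz_space schwartz_span.add]) (rule schwartz_span.base, assumption)+

lemma schwartz_space_cmult: "g \<in> schwartz_space \<Longrightarrow> (\<lambda>x. c * g x) \<in> schwartz_space"
  by (rule subsetD[OF schwartz_span_schwartz_space schwartz_span.cmult[OF schwartz_span.base]])

lemma schwartz_space_coord:
  "g \<in> schwartz_space \<Longrightarrow> (\<lambda>x. complex_of_real (x \<bullet> v) * g x) \<in> schwartz_space"
  by (rule subsetD[OF schwartz_span_schwartz_space schwartz_span.coord[OF schwartz_span.base]])

lemma schwartz_space_uminus_arg:
  assumes "g \<in> schwartz_space"
  shows "(\<lambda>x. g (- x)) \<in> schwartz_space"
proof (rule schwartz_space_coinduct)
  \<comment> \<open>The chain rule contributes a factor -1 at each derivative; the free scalar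
    \<open>c\<close> absorbs it.\<close>
  let ?A = "{\<lambda>x. c * g (- x) |c g. g \<in> schwartz_space}"
  have "(\<lambda>x. g (- x)) = (\<lambda>x. 1 * g (- x))" by simp
  then show "(\<lambda>x. g (- x)) \<in> ?A" using assms by blast
  fix h :: "'a \<Rightarrow> complex" assume "h \<in> ?A"
  then obtain c g where h: "h = (\<lambda>x. c * g (- x))" and g: "g \<in> schwartz_space" by blast
  have D: "(h has_derivative (\<lambda>y. c * frechet_derivative g (at (- x)) (- y))) (at x)" for x
    unfolding h
    by (rule has_derivative_mult_right has_derivative_compose[where f=uminus, simplified])
       (auto intro!: derivative_eq_intros has_derivative_partial schwartz_spaceD g)
  show "h differentiable_on UNIV" using D by (auto simp: differentiable_on_def differentiable_def)
  show "rapidly_decreasing h" unfolding h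
  proof (rule rapidly_decreasing_mult[where B="norm c" and m=0])
    show "rapidly_decreasing (\<lambda>x. g (- x))"
      using schwartz_spaceD(2)[OF g] unfolding rapidly_decreasing_def by (metis norm_minus_cancel)
  qed simp
  fix b :: 'a assume b: "b \<in> Basis"
  have lin: "linear (frechet_derivative g (at y))" for y
    using has_derivative_partial[OF schwartz_spaceD(1)[OF g], of y]
      has_derivative_linear by blast
  have "partial_deriv b h = (\<lambda>x. (- c) * partial_deriv b g (- x))"
    by (rule ext, subst partial_deriv_eq[OF D]) (simp add: partial_deriv_def linear_neg[OF lin])
  then show "partial_deriv b h \<in> ?A" using schwartz_spaceD(3)[OF g b] by blast
qed

section \<open>Integrability of rapidly decreasing functions\<close>

lemma lborel_integrable_prod:
  fixes f :: "'a::euclidean_space \<Rightarrow> real \<Rightarrow> 'c::{real_normed_field,banach,second_countable_topology}"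
  assumes f: "\<And>b. b \<in> Basis \<Longrightarrow> integrable lborel (f b)"
  shows "integrable lborel (\<lambda>x::'a. \<Prod>b\<in>Basis. f b (x \<bullet> b))" (is ?A)
    and "(\<integral>x. (\<Prod>b\<in>Basis. f b (x \<bullet> b)) \<partial>lborel) = (\<Prod>b\<in>Basis. \<integral>t. f b t \<partial>lborel)" (is ?B)
proof -
  interpret product_sigma_finite "\<lambda>_::'a. lborel::real measure"
    by standard
  have [measurable]: "f b \<in> borel_measurable borel" if "b \<in> Basis" for b
    using f[OF that] by auto
  \<comment> \<open>\<open>lborel\<close> is the image of the product measure under this map from
    coordinates to vectors, which reduces both claims to Fubini for finite products.\<close>
  have T: "(\<lambda>y. \<Sum>b\<in>Basis. y b *\<^sub>R b) \<in> measurable (\<Pi>\<^sub>M b\<in>(Basis::'a set). lborel) borel"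
    by measurable
  have F: "(\<lambda>x::'a. \<Prod>b\<in>Basis. f b (x \<bullet> b)) \<in> borel_measurable borel"
    by measurable
  have c: "(\<Prod>b\<in>Basis. f b ((\<Sum>b\<in>Basis. y b *\<^sub>R b) \<bullet> b)) = (\<Prod>b\<in>(Basis::'a set). f b (y b))" for y
    by (intro prod.cong) auto
  show ?A
    by (subst lborel_eq, subst integrable_distr_eq[OF T F], unfold c, rule product_integrable_prod)
       (auto intro: f)
  show ?B
    by (subst lborel_eq, subst integral_distr[OF T F], unfold c, rule product_integral_prod)
       (auto intro: f)
qed

text \<open>Comparison with the product of the one-dimensional functions 1 / (1 + t^2): each factor
  costs two powers of 1 + |x|. This is where the exponent \<open>2 * DIM('a)\<close> of the later
  integrability estimates comes from.\<close>

lemma integrable_inverse_power_norm: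
  assumes k: "2 * DIM('a) \<le> k"
  shows "integrable lborel (\<lambda>x::'a::euclidean_space. 1 / (1 + norm x) ^ k)"
proof (rule Bochner_Integration.integrable_bound)
  have "integrable lborel (\<lambda>t::real. inverse (1 + t\<^sup>2))"
    using integrable_inverse_1_plus_square by (simp add: set_integrable_def)
  then show "integrable lborel (\<lambda>x::'a. \<Prod>b\<in>Basis. inverse (1 + (x \<bullet> b)\<^sup>2))"
    by (rule lborel_integrable_prod(1))
  show "AE x::'a in lborel. norm (1 / (1 + norm x) ^ k) \<le>
      norm (\<Prod>b\<in>Basis. inverse (1 + (x \<bullet> b)\<^sup>2))"
  proof (rule AE_I2)
    fix x :: 'a
    have 1: "1 + (x \<bullet> b)\<^sup>2 \<le> (1 + norm x)\<^sup>2" if "b \<in> Basis" for b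
    proof -
      have "(x \<bullet> b)\<^sup>2 \<le> (norm x)\<^sup>2"
        using Basis_le_norm[OF that, of x] by (metis abs_norm_cancel abs_le_square_iff)
      then show ?thesis by (simp add: power2_eq_square algebra_simps add_increasing2)
    qed
    have "(\<Prod>b\<in>(Basis::'a set). 1 + (x \<bullet> b)\<^sup>2) \<le> (\<Prod>b\<in>(Basis::'a set). (1 + norm x)\<^sup>2)"
      by (intro prod_mono conjI 1) auto
    also have "\<dots> = (1 + norm x) ^ (2 * DIM('a))"
      by (simp add: power_mult)
    also have "\<dots> \<le> (1 + norm x) ^ k" by (intro power_increasing k) auto
    finally have 2: "(\<Prod>b\<in>(Basis::'a set). 1 + (x \<bullet> b)\<^sup>2) \<le> (1 + norm x) ^ k" .
    have 3: "0 < (\<Prod>b\<in>(Basis::'a set). 1 + (x \<bullet> b)\<^sup>2)"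
      by (intro prod_pos) (auto simp: add_pos_nonneg)
    have "norm (1 / (1 + norm x) ^ k) = 1 / (1 + norm x) ^ k" by simp
    also have "\<dots> \<le> 1 / (\<Prod>b\<in>(Basis::'a set). 1 + (x \<bullet> b)\<^sup>2)"
      using 2 3 by (intro divide_left_mono mult_pos_pos) auto
    also have "\<dots> = norm (\<Prod>b\<in>(Basis::'a set). inverse (1 + (x \<bullet> b)\<^sup>2))"
      using 3 prod_inversef[of "\<lambda>b. 1 + (x \<bullet> b)\<^sup>2" Basis] by (simp add: o_def inverse_eq_divide)
    finally show "norm (1 / (1 + norm x) ^ k) \<le> norm (\<Prod>b\<in>(Basis::'a set). inverse (1 + (x \<bullet> b)\<^sup>2))" .
  qed
qed measurable

lemma schwartz_space_measurable:
  "g \<in> schwartz_space \<Longrightarrow> g \<in> borel_measurable borel"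
  by (intro borel_measurable_continuous_onI differentiable_imp_continuous_on schwartz_spaceD)

lemma schwartz_space_continuous:
  "g \<in> schwartz_space \<Longrightarrow> continuous_on UNIV g"
  by (intro differentiable_imp_continuous_on schwartz_spaceD)

lemma norm_le_weighted:
  fixes x :: "'a::real_normed_vector" and c :: "'b::real_normed_vector"
  assumes "(1 + norm x) ^ k * norm c \<le> C"
  shows "norm c \<le> C * (1 / (1 + norm x) ^ k)"
  using assms by (simp add: pos_le_divide_eq mult.commute add_pos_nonneg)

lemma rapidly_decreasing_integrable_norm:
  fixes g :: "'a::euclidean_space \<Rightarrow> complex"
  assumes [measurable]: "g \<in> borel_measurable borel"
    and C: "\<And>x. (1 + norm x) ^ (2 * DIM('a)) * norm (g x) \<le> C"
  shows "integrable lborel g"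
    and "(\<integral>x. norm (g x) \<partial>lborel) \<le> C * (\<integral>x. 1 / (1 + norm (x::'a)) ^ (2 * DIM('a)) \<partial>lborel)"
proof -
  have i: "integrable lborel (\<lambda>x::'a. C * (1 / (1 + norm x) ^ (2 * DIM('a))))"
    by (intro integrable_mult_right integrable_inverse_power_norm) auto
  have b: "norm (g x) \<le> C * (1 / (1 + norm x) ^ (2 * DIM('a)))" for x
    by (rule norm_le_weighted[OF C])
  show g: "integrable lborel g"
    by (rule Bochner_Integration.integrable_bound[OF i])
       (use b in \<open>auto intro!: AE_I2 order_trans[OF b] divide_right_mono\<close>)
  have "(\<integral>x. norm (g x) \<partial>lborel) \<le> (\<integral>x. C * (1 / (1 + norm (x::'a)) ^ (2 * DIM('a))) \<partial>lborel)"
    by (intro integral_mono integrable_norm g i b)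
  also have "\<dots> = C * (\<integral>x. 1 / (1 + norm (x::'a)) ^ (2 * DIM('a)) \<partial>lborel)"
    by (rule integral_mult_right_zero)
  finally show "(\<integral>x. norm (g x) \<partial>lborel) \<le> \<dots>" .
qed

lemma schwartz_space_weight_integrable:
  fixes g :: "'a::euclidean_space \<Rightarrow> complex"
  assumes "g \<in> schwartz_space"
  shows "integrable lborel (\<lambda>x. (1 + norm x) ^ k * norm (g x))"
proof -
  have [measurable]: "g \<in> borel_measurable borel" using assms by (rule schwartz_space_measurable)
  obtain C where C: "\<And>x. (1 + norm x) ^ (2 * DIM('a) + k) * norm (g x) \<le> C"
    using schwartz_spaceD(2)[OF assms] unfolding rapidly_decreasing_def by blast
  \<comment> \<open>The integrability criterion is for complex functions, so the real weight passes
    through \<open>complex_of_real\<close>.\<close>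
  have "integrable lborel (\<lambda>x. complex_of_real ((1 + norm x) ^ k * norm (g x)))"
    by (rule rapidly_decreasing_integrable_norm(1)[where C=C])
       (use C in \<open>auto simp: power_add mult.assoc abs_mult simp flip: of_real_mult\<close>)
  then show ?thesis by (rule iffD1[OF complex_of_real_integrable_eq])
qed

lemma schwartz_space_integrable:
  assumes "g \<in> schwartz_space"
  shows "integrable lborel g"
  using schwartz_space_weight_integrable[OF assms, of 0] schwartz_space_measurable[OF assms]
  by (simp add: integrable_norm_iff)

section \<open>The Fourier transform on the Schwartz space\<close>

lemma integrable_fourier_integrand:
  assumes "integrable lborel f"
  shows "integrable lborel (\<lambda>x. exp (- (\<i> * complex_of_real (x \<bullet> \<xi>))) * f x)"
  by (rule Bochner_Integration.integrable_bound[OF assms])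
     (use assms in \<open>auto simp: norm_mult\<close>)

lemma norm_fourier_le: "norm (fourier f \<xi>) \<le> (\<integral>x. norm (f x) \<partial>lborel)"
proof -
  have "norm (fourier f \<xi>) \<le> (\<integral>x. norm (exp (- (\<i> * complex_of_real (x \<bullet> \<xi>))) * f x) \<partial>lborel)"
    unfolding fourier_def by (rule integral_norm_bound)
  then show ?thesis by (simp add: norm_mult)
qed

lemma fourier_cmult: "fourier (\<lambda>x. c * f x) \<xi> = c * fourier f \<xi>"
  unfolding fourier_def by (simp add: mult.left_commute)

lemma fourier_add:
  assumes "integrable lborel f" "integrable lborel g"
  shows "fourier (\<lambda>x. f x + g x) \<xi> = fourier f \<xi> + fourier g \<xi>"
  unfolding fourier_def
  by (simp add: distrib_left integrable_fourier_integrand assms)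

lemma fourier_measurable [measurable]:
  assumes [measurable]: "f \<in> borel_measurable borel"
  shows "fourier f \<in> borel_measurable borel"
  unfolding fourier_def[abs_def] by measurable

text \<open>Instead of dominated convergence, an explicit error estimate: |e^(is) - 1 - is| is at
  most s^2 / 2, so the remainder is bounded by |h|^2 times a weighted second moment of
  \<open>g\<close>.\<close>

lemma fourier_has_derivative:
  fixes g :: "'a::euclidean_space \<Rightarrow> complex"
  assumes g: "g \<in> schwartz_space"
  shows "(fourier g has_derivative (\<lambda>h. fourier (\<lambda>x. - \<i> * (complex_of_real (x \<bullet> h) * g x)) \<xi>)) (at \<xi>)"
proof -
  define K where "K = (\<integral>x. (1 + norm x) ^ 1 * norm (g x) \<partial>lborel)"
  define L where "L = (\<integral>x. (1 + norm x) ^ 2 * norm (g x) \<partial>lborel)"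
  let ?D = "\<lambda>h. fourier (\<lambda>x. - \<i> * (complex_of_real (x \<bullet> h) * g x)) \<xi>"
  let ?e = "\<lambda>x \<xi>. exp (- (\<i> * complex_of_real (x \<bullet> \<xi>)))"
  have c: "(\<lambda>x. complex_of_real (x \<bullet> h) * g x) \<in> schwartz_space" for h
    by (rule schwartz_space_coord[OF g])
  have nn: "norm (complex_of_real (x \<bullet> h) * g x) \<le> norm h * ((1 + norm x) ^ 1 * norm (g x))" for x h :: 'a
  proof -
    have "\<bar>x \<bullet> h\<bar> \<le> norm h * (1 + norm x)"
      using Cauchy_Schwarz_ineq2[of x h] by (simp add: algebra_simps add_increasing)
    from mult_right_mono[OF this norm_ge_zero[of "g x"]]
    show ?thesis by (simp add: norm_mult mult.assoc)
  qed
  have "bounded_linear ?D"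
  proof (rule bounded_linear_intro[where K=K])
    show "?D (h + k) = ?D h + ?D k" for h k
      unfolding fourier_cmult
      using fourier_add[OF schwartz_space_integrable[OF c] schwartz_space_integrable[OF c], of h k \<xi>]
      by (simp add: inner_add_right algebra_simps)
    show "?D (r *\<^sub>R h) = r *\<^sub>R ?D h" for r h
      using fourier_cmult[of "complex_of_real r" "\<lambda>x. - \<i> * (complex_of_real (x \<bullet> h) * g x)" \<xi>]
      by (simp add: scaleR_conv_of_real mult_ac)
    show "norm (?D h) \<le> norm h * K" for h
    proof -
      have "norm (?D h) \<le> (\<integral>x. norm (complex_of_real (x \<bullet> h) * g x) \<partial>lborel)"
        using norm_fourier_le[of "\<lambda>x. - \<i> * (complex_of_real (x \<bullet> h) * g x)" \<xi>]
        by (simp add: norm_mult)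
      also have "\<dots> \<le> (\<integral>x. norm h * ((1 + norm x) ^ 1 * norm (g x)) \<partial>lborel)"
        by (intro integral_mono nn integrable_norm integrable_mult_right
            schwartz_space_integrable[OF c] schwartz_space_weight_integrable g)
      also have "\<dots> = norm h * K" unfolding K_def by (rule integral_mult_right_zero)
      finally show ?thesis .
    qed
  qed
  moreover have "((\<lambda>h. norm (fourier g (\<xi> + h) - fourier g \<xi> - ?D h) / norm h) \<longlongrightarrow> 0) (at 0)"
  proof (rule tendsto_sandwich)
    have R: "norm (fourier g (\<xi> + h) - fourier g \<xi> - ?D h) \<le> (norm h)\<^sup>2 * L" for h
    proof -
      \<comment> \<open>After extracting the phase at \<xi>, the error is the transform of
        \<open>g\<close> times the first-order Taylor remainder of the exponential; the sum over
        \<open>k \<le> 1\<close> is the form in which \<open>iexp_approx1\<close> bounds it.\<close>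
      let ?r = "\<lambda>x. (exp (\<i> * complex_of_real (- (x \<bullet> h))) - (\<Sum>k\<le>1. (\<i> * complex_of_real (- (x \<bullet> h))) ^ k / fact k)) * g x"
      have "fourier g (\<xi> + h) - fourier g \<xi> - ?D h =
          (\<integral>x. ?e x (\<xi> + h) * g x - ?e x \<xi> * g x - ?e x \<xi> * (- \<i> * (complex_of_real (x \<bullet> h) * g x)) \<partial>lborel)"
        unfolding fourier_def
        by (subst Bochner_Integration.integral_diff Bochner_Integration.integral_diff[symmetric];
            (intro Bochner_Integration.integrable_diff integrable_fourier_integrand
              integrable_mult_right schwartz_space_integrable c g refl)?)+
      also have "\<dots> = fourier ?r \<xi>"
        unfolding fourier_def
        by (intro Bochner_Integration.integral_cong refl)
           (simp add: inner_add_right exp_add[symmetric] algebra_simps mult_exp_exp)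
      finally have "norm (fourier g (\<xi> + h) - fourier g \<xi> - ?D h) = norm (fourier ?r \<xi>)" by simp
      also have "\<dots> \<le> (\<integral>x. norm (?r x) \<partial>lborel)" by (rule norm_fourier_le)
      also have "\<dots> \<le> (\<integral>x. (norm h)\<^sup>2 * ((1 + norm x) ^ 2 * norm (g x)) \<partial>lborel)"
      proof (rule integral_mono')
        show "integrable lborel (\<lambda>x. (norm h)\<^sup>2 * ((1 + norm x) ^ 2 * norm (g x)))"
          by (intro integrable_mult_right schwartz_space_weight_integrable g)
        fix x :: 'a
        have "norm (exp (\<i> * complex_of_real (- (x \<bullet> h))) - (\<Sum>k\<le>1. (\<i> * complex_of_real (- (x \<bullet> h))) ^ k / fact k))
            \<le> \<bar>- (x \<bullet> h)\<bar> ^ Suc 1 / fact (Suc 1)"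
          by (rule iexp_approx1)
        also have "\<dots> \<le> (x \<bullet> h)\<^sup>2" by (simp add: numeral_2_eq_2[symmetric])
        also have "\<dots> \<le> (norm x * norm h)\<^sup>2"
          using Cauchy_Schwarz_ineq2[of x h] by (simp add: abs_le_square_iff[symmetric])
        also have "\<dots> \<le> (norm h)\<^sup>2 * (1 + norm x)\<^sup>2"
          by (simp add: power_mult_distrib mult.commute mult_left_mono power_mono)
        finally show "norm (?r x) \<le> (norm h)\<^sup>2 * ((1 + norm x) ^ 2 * norm (g x))"
          unfolding norm_mult mult.assoc[symmetric] by (rule mult_right_mono) simp
      qed auto
      also have "\<dots> = (norm h)\<^sup>2 * L" unfolding L_def by (rule integral_mult_right_zero)
      finally show ?thesis .
    qed
    show "\<forall>\<^sub>F h in at 0. 0 \<le> norm (fourier g (\<xi> + h) - fourier g \<xi> - ?D h) / norm h" by simp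
    show "\<forall>\<^sub>F h in at 0. norm (fourier g (\<xi> + h) - fourier g \<xi> - ?D h) / norm h \<le> norm h * L"
      using R by (auto simp: eventually_at_filter divide_simps power2_eq_square mult_ac)
    have "((\<lambda>h::'a. norm h * L) \<longlongrightarrow> norm (0::'a) * L) (at 0)"
      by (intro tendsto_mult tendsto_norm tendsto_ident_at tendsto_const)
    then show "((\<lambda>h::'a. norm h * L) \<longlongrightarrow> 0) (at 0)" by simp
    show "((\<lambda>h::'a. 0::real) \<longlongrightarrow> 0) (at 0)" by simp
  qed
  ultimately show ?thesis unfolding has_derivative_at by blast
qed

section \<open>Derivatives become multiplication by coordinates\<close>

lemma difference_quotient_LIMSEQ:
  fixes f :: "'a::real_normed_vector \<Rightarrow> 'b::real_normed_vector"
  assumes f: "(f has_derivative D) (at x)"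
  shows "(\<lambda>n. (1 / inverse (real (Suc n))) *\<^sub>R (f (x + inverse (real (Suc n)) *\<^sub>R v) - f x)) \<longlonglongrightarrow> D v"
proof -
  have lin: "linear D" using f by (rule has_derivative_linear)
  have "((\<lambda>t. x + t *\<^sub>R v) has_derivative (\<lambda>t. t *\<^sub>R v)) (at (0::real))"
    by (auto intro!: derivative_eq_intros)
  then have "((\<lambda>t. f (x + t *\<^sub>R v)) has_derivative (\<lambda>t. D (t *\<^sub>R v))) (at (0::real))"
    using has_derivative_compose[of "\<lambda>t. x + t *\<^sub>R v" "\<lambda>t. t *\<^sub>R v" "0::real" UNIV f D] f by simp
  then have "((\<lambda>t. f (x + t *\<^sub>R v)) has_vector_derivative D v) (at (0::real))"
    by (simp add: has_vector_derivative_def linear.scaleR[OF lin])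
  then have *: "((\<lambda>t. norm (f (x + t *\<^sub>R v) - f x - t *\<^sub>R D v) / norm t) \<longlongrightarrow> 0) (at 0)"
    by (simp add: has_vector_derivative_def has_derivative_at)
  \<comment> \<open>A sequence of increments instead of a continuous parameter, because the
    quotients are going to be integrated by dominated convergence.\<close>
  let ?t = "\<lambda>n. inverse (real (Suc n))"
  have "filterlim ?t (at 0) sequentially"
    using LIMSEQ_inverse_real_of_nat by (simp add: filterlim_at)
  from filterlim_compose[OF * this]
  have "(\<lambda>n. norm (f (x + ?t n *\<^sub>R v) - f x - ?t n *\<^sub>R D v) / norm (?t n)) \<longlonglongrightarrow> 0" .
  moreover have "norm (f (x + ?t n *\<^sub>R v) - f x - ?t n *\<^sub>R D v) / norm (?t n) =
      norm ((1 / ?t n) *\<^sub>R (f (x + ?t n *\<^sub>R v) - f x) - D v)" for n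
  proof -
    have "(1 / ?t n) *\<^sub>R (f (x + ?t n *\<^sub>R v) - f x) - D v =
        (1 / ?t n) *\<^sub>R (f (x + ?t n *\<^sub>R v) - f x - ?t n *\<^sub>R D v)"
      by (simp add: scaleR_diff_right)
    then show ?thesis by (simp only: norm_scaleR) simp
  qed
  ultimately show ?thesis by (simp add: tendsto_norm_zero_iff flip: LIM_zero_iff[of _ "D v"])
qed

text \<open>Instead of integrating by parts, differentiate the transform of the translate of \<open>g\<close> by \<open>t b\<close>
  at \<open>t = 0\<close>.\<close>

lemma fourier_partial_deriv:
  fixes g :: "'a::euclidean_space \<Rightarrow> complex"
  assumes g: "g \<in> schwartz_space" and b: "b \<in> Basis"
  shows "fourier (partial_deriv b g) \<xi> = \<i> * complex_of_real (b \<bullet> \<xi>) * fourier g \<xi>"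
proof -
  let ?t = "\<lambda>n. inverse (real (Suc n))"
  let ?e = "\<lambda>x. exp (- (\<i> * complex_of_real (x \<bullet> \<xi>)))"
  let ?q = "\<lambda>n x. (1 / ?t n) *\<^sub>R (g (x + ?t n *\<^sub>R b) - g x)"
  let ?k = "2 * DIM('a)"
  have g': "partial_deriv b g \<in> schwartz_space" by (rule schwartz_spaceD(3)[OF g b])
  note gi = schwartz_space_integrable[OF g]
  have [measurable]: "g \<in> borel_measurable borel" "partial_deriv b g \<in> borel_measurable borel"
    by (intro schwartz_space_measurable g g')+
  obtain C where C: "\<And>x. (1 + norm x) ^ ?k * norm (partial_deriv b g x) \<le> C"
    using schwartz_spaceD(2)[OF g'] unfolding rapidly_decreasing_def by blast
  have C0: "0 \<le> C" using order_trans[OF _ C[of 0]] by simp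
  \<comment> \<open>Mean value inequality along the segment from x to x + t b. On it 1 + |x| \<le> 2
    (1 + |x + s b|) because |s b| \<le> 1, whence the factor \<open>2 ^ ?k\<close> and a dominating
    function independent of n.\<close>
  have bound: "norm (?q n x) \<le> 2 ^ ?k * C * (1 / (1 + norm x) ^ ?k)" for n x
  proof -
    let ?B = "2 ^ ?k * C * (1 / (1 + norm x) ^ ?k)"
    let ?G = "\<lambda>s::real. g (x + s *\<^sub>R b)"
    have "norm (?G (?t n) - ?G 0) \<le> ?B * norm (?t n - 0)"
    proof (rule differentiable_bound)
      show "convex {0..1::real}" by simp
      show "?t n \<in> {0..1}" "(0::real) \<in> {0..1}" by (auto simp: field_simps)
      fix s :: real assume s: "s \<in> {0..1}"
      show "(?G has_derivative (\<lambda>h. frechet_derivative g (at (x + s *\<^sub>R b)) (h *\<^sub>R b))) (at s within {0..1})"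
        by (rule has_derivative_compose[where f="\<lambda>s. x + s *\<^sub>R b" and g=g])
           (auto intro!: derivative_eq_intros has_derivative_partial schwartz_spaceD g)
      have lin: "linear (frechet_derivative g (at (x + s *\<^sub>R b)))"
        using has_derivative_partial[OF schwartz_spaceD(1)[OF g]] by (rule has_derivative_linear)
      have norm_sb: "norm (s *\<^sub>R b) \<le> 1" using s b by simp
      have "norm x \<le> norm (x + s *\<^sub>R b) + norm (s *\<^sub>R b)"
        using norm_triangle_ineq4[of "x + s *\<^sub>R b" "s *\<^sub>R b"] by simp
      then have "1 + norm x \<le> 2 * (1 + norm (x + s *\<^sub>R b))"
        using norm_sb by (smt (verit) norm_ge_zero)
      then have "(1 + norm x) ^ ?k \<le> (2 * (1 + norm (x + s *\<^sub>R b))) ^ ?k"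
        by (intro power_mono) auto
      then have "(1 + norm x) ^ ?k * norm (partial_deriv b g (x + s *\<^sub>R b)) \<le>
          2 ^ ?k * ((1 + norm (x + s *\<^sub>R b)) ^ ?k * norm (partial_deriv b g (x + s *\<^sub>R b)))"
        unfolding power_mult_distrib mult.assoc[symmetric] by (rule mult_right_mono) simp
      also have "\<dots> \<le> 2 ^ ?k * C" by (intro mult_left_mono C) simp
      finally have B: "norm (partial_deriv b g (x + s *\<^sub>R b)) \<le> ?B"
        by (rule norm_le_weighted)
      show "onorm (\<lambda>h. frechet_derivative g (at (x + s *\<^sub>R b)) (h *\<^sub>R b)) \<le> ?B"
      proof (rule onorm_bound)
        show "0 \<le> ?B" using C0 by simp
        show "norm (frechet_derivative g (at (x + s *\<^sub>R b)) (h *\<^sub>R b)) \<le> ?B * norm h" for h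
          using mult_right_mono[OF B norm_ge_zero[of h]]
          by (simp add: linear.scaleR[OF lin] partial_deriv_def mult.commute)
      qed
    qed
    then have "real (Suc n) * norm (g (x + ?t n *\<^sub>R b) - g x) \<le> real (Suc n) * (?B * ?t n)"
      by (intro mult_left_mono) auto
    also have "\<dots> = ?B" by simp
    finally show ?thesis by (simp add: divide_inverse mult_ac)
  qed
  have "(\<lambda>n. \<integral>x. ?e x * ?q n x \<partial>lborel) \<longlonglongrightarrow> (\<integral>x. ?e x * partial_deriv b g x \<partial>lborel)"
  proof (rule integral_dominated_convergence)
    show "integrable lborel (\<lambda>x. 2 ^ ?k * C * (1 / (1 + norm (x::'a)) ^ ?k))"
      by (intro integrable_mult_right integrable_inverse_power_norm) auto
    show "AE x in lborel. (\<lambda>n. ?e x * ?q n x) \<longlonglongrightarrow> ?e x * partial_deriv b g x"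
      unfolding partial_deriv_def
      by (intro AE_I2 tendsto_mult_left difference_quotient_LIMSEQ has_derivative_partial schwartz_spaceD g)
    show "AE x in lborel. norm (?e x * ?q n x) \<le> 2 ^ ?k * C * (1 / (1 + norm x) ^ ?k)" for n
      using bound[of n] by (simp add: norm_mult)
  qed measurable
  \<comment> \<open>The \<open>0 +\<close> and the direction \<open>1\<close> exhibit the scalar
    factor as a difference quotient at 0 of the function sending s to exp (i s (b \<bullet> \<xi>)),
    so that \<open>difference_quotient_LIMSEQ\<close> applies to it as well.\<close>
  moreover have "(\<integral>x. ?e x * ?q n x \<partial>lborel) =
      ((1 / ?t n) *\<^sub>R (exp (\<i> * complex_of_real ((0 + ?t n *\<^sub>R 1) * (b \<bullet> \<xi>))) - exp (\<i> * complex_of_real (0 * (b \<bullet> \<xi>))))) * fourier g \<xi>" for n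
  proof -
    have "(\<integral>x. ?e x * ?q n x \<partial>lborel) =
        (\<integral>x. (1 / ?t n) *\<^sub>R (?e x * g (x + ?t n *\<^sub>R b) - ?e x * g x) \<partial>lborel)"
      by (simp only: mult_scaleR_right right_diff_distrib)
    also have "\<dots> = (1 / ?t n) *\<^sub>R (fourier (\<lambda>x. g (x + ?t n *\<^sub>R b)) \<xi> - fourier g \<xi>)"
      unfolding fourier_def
      by (subst integral_scaleR_right, subst Bochner_Integration.integral_diff)
         (intro integrable_fourier_integrand lborel_translate(1) gi refl)+
    also have "\<dots> = (1 / ?t n) *\<^sub>R ((exp (\<i> * complex_of_real (?t n * (b \<bullet> \<xi>))) - 1) * fourier g \<xi>)"
      by (simp add: fourier_translate[OF gi] left_diff_distrib)
    finally show ?thesis by simp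
  qed
  moreover have "(\<lambda>n. ((1 / ?t n) *\<^sub>R (exp (\<i> * complex_of_real ((0 + ?t n *\<^sub>R 1) * (b \<bullet> \<xi>))) - exp (\<i> * complex_of_real (0 * (b \<bullet> \<xi>))))) * fourier g \<xi>)
      \<longlonglongrightarrow> (\<i> * complex_of_real (1 * (b \<bullet> \<xi>))) * fourier g \<xi>"
  proof (intro tendsto_mult_right difference_quotient_LIMSEQ)
    have "((\<lambda>s. \<i> * complex_of_real (s * (b \<bullet> \<xi>))) has_derivative (\<lambda>s. \<i> * complex_of_real (s * (b \<bullet> \<xi>)))) (at (0::real))"
      by (auto intro!: derivative_eq_intros)
    from has_derivative_compose[OF this, of exp] DERIV_exp[of "0::complex"]
    show "((\<lambda>s. exp (\<i> * complex_of_real (s * (b \<bullet> \<xi>)))) has_derivative (\<lambda>s. \<i> * complex_of_real (s * (b \<bullet> \<xi>)))) (at (0::real))"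
      by (fastforce simp: has_field_derivative_def)
  qed
  ultimately show ?thesis
    unfolding fourier_def[of "partial_deriv b g"] by (simp add: LIMSEQ_unique)
qed

section \<open>Decay and continuity of the transform\<close>

lemma foldr_partial_deriv_schwartz_space:
  "g \<in> schwartz_space \<Longrightarrow> bs \<in> lists Basis \<Longrightarrow> foldr partial_deriv bs g \<in> schwartz_space"
  by (induction bs) (auto intro: schwartz_spaceD(3))

lemma fourier_iterated_partial_deriv:
  assumes g: "g \<in> schwartz_space" and b: "b \<in> Basis"
  shows "fourier (foldr partial_deriv (replicate k b) g) \<xi> =
    (\<i> * complex_of_real (b \<bullet> \<xi>)) ^ k * fourier g \<xi>"
proof (induction k)
  case (Suc k)
  have "foldr partial_deriv (replicate k b) g \<in> schwartz_space"
    by (rule foldr_partial_deriv_schwartz_space[OF g]) (use b in auto)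
  then show ?case by (simp add: fourier_partial_deriv b Suc.IH[unfolded foldr_replicate])
qed simp

text \<open>Controls the weight by pure powers of single coordinates, so that only repeated
  derivatives in one direction enter below and no mixed ones. The source is 1 + |x| \<le> (n + 1)
  max(1, M), where M is the largest absolute value of a coordinate.\<close>

lemma power_one_plus_norm_le:
  fixes x :: "'a::euclidean_space"
  shows "(1 + norm x) ^ k \<le> real (DIM('a) + 1) ^ k * (1 + (\<Sum>b\<in>Basis. \<bar>b \<bullet> x\<bar> ^ k))"
proof -
  define M where "M = Max ((\<lambda>b. \<bar>b \<bullet> x\<bar>) ` Basis)"
  have le: "\<bar>b \<bullet> x\<bar> \<le> M" if "b \<in> Basis" for b
    unfolding M_def using that by (intro Max_ge) auto
  have "M \<in> (\<lambda>b. \<bar>b \<bullet> x\<bar>) ` Basis" unfolding M_def by (intro Max_in) auto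
  then obtain b where b: "b \<in> Basis" "M = \<bar>b \<bullet> x\<bar>" by blast
  have "norm x \<le> (\<Sum>b\<in>Basis. \<bar>b \<bullet> x\<bar>)" using norm_le_l1[of x] by (simp add: inner_commute)
  also have "\<dots> \<le> real DIM('a) * max 1 M"
    using sum_mono[of Basis "\<lambda>b. \<bar>b \<bullet> x\<bar>" "\<lambda>_. max 1 M"] le by (simp add: max.coboundedI2)
  finally have "1 + norm x \<le> real (DIM('a) + 1) * max 1 M"
    by (simp add: distrib_right)
  then have "(1 + norm x) ^ k \<le> (real (DIM('a) + 1) * max 1 M) ^ k" by (intro power_mono) auto
  also have "\<dots> = real (DIM('a) + 1) ^ k * (max 1 M) ^ k" by (rule power_mult_distrib)
  also have "(max 1 M) ^ k \<le> 1 + M ^ k"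
    using b(2) by (simp add: max_def)
  also have "M ^ k \<le> (\<Sum>b\<in>Basis. \<bar>b \<bullet> x\<bar> ^ k)"
    unfolding b(2) using b(1) by (intro member_le_sum[where f="\<lambda>b. \<bar>b \<bullet> x\<bar> ^ k"]) auto
  finally show ?thesis by (simp add: mult_left_mono)
qed

text \<open>The transform exchanges k-th powers of a coordinate for k-fold derivatives, and a
  transform is bounded by the L1 norm.\<close>

lemma fourier_weighted_le:
  fixes g :: "'a::euclidean_space \<Rightarrow> complex"
  assumes g: "g \<in> schwartz_space"
  shows "(1 + norm \<xi>) ^ k * norm (fourier g \<xi>) \<le> real (DIM('a) + 1) ^ k *
    ((\<integral>x. norm (g x) \<partial>lborel) +
     (\<Sum>b\<in>Basis. \<integral>x. norm (foldr partial_deriv (replicate k b) g x) \<partial>lborel))"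
proof -
  have "(1 + norm \<xi>) ^ k * norm (fourier g \<xi>) \<le>
      real (DIM('a) + 1) ^ k * (1 + (\<Sum>b\<in>Basis. \<bar>b \<bullet> \<xi>\<bar> ^ k)) * norm (fourier g \<xi>)"
    by (intro mult_right_mono power_one_plus_norm_le) auto
  also have "\<dots> = real (DIM('a) + 1) ^ k *
      (norm (fourier g \<xi>) + (\<Sum>b\<in>Basis. norm (fourier (foldr partial_deriv (replicate k b) g) \<xi>)))"
    by (simp add: fourier_iterated_partial_deriv[OF g] norm_mult norm_power distrib_right
        sum_distrib_right mult.assoc del: foldr_replicate)
  also have "\<dots> \<le> real (DIM('a) + 1) ^ k *
    ((\<integral>x. norm (g x) \<partial>lborel) +
     (\<Sum>b\<in>Basis. \<integral>x. norm (foldr partial_deriv (replicate k b) g x) \<partial>lborel))"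
    by (intro mult_left_mono add_mono sum_mono norm_fourier_le) auto
  finally show ?thesis .
qed

text \<open>Coinduction on the image of the Schwartz space: a partial derivative of a transform is
  the transform of a coordinate multiple, hence again in the image.\<close>

lemma fourier_schwartz_space:
  assumes "g \<in> schwartz_space"
  shows "fourier g \<in> schwartz_space"
proof (rule schwartz_space_coinduct[where A="fourier ` schwartz_space"])
  fix h :: "'a \<Rightarrow> complex" assume "h \<in> fourier ` schwartz_space"
  then obtain g where g: "g \<in> schwartz_space" and h: "h = fourier g" by blast
  show "h differentiable_on UNIV"
    unfolding h using fourier_has_derivative[OF g] by (auto simp: differentiable_on_def differentiable_def)
  show "rapidly_decreasing h"
    unfolding h rapidly_decreasing_def using fourier_weighted_le[OF g] by blast
  fix b :: 'a
  have "partial_deriv b h = fourier (\<lambda>x. - \<i> * (complex_of_real (x \<bullet> b) * g x))"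
    unfolding h by (intro ext partial_deriv_eq fourier_has_derivative g)
  then show "partial_deriv b h \<in> fourier ` schwartz_space"
    by (simp only:) (intro imageI schwartz_space_cmult schwartz_space_coord g)
qed (use assms in simp)

lemma schwartz_weighted_le_seminorm:
  assumes "g \<in> schwartz_space" "bs \<in> lists Basis"
  shows "schwartz_weighted k bs g x \<le> schwartz_seminorm k bs g"
  unfolding schwartz_seminorm_def
  using assms by (intro cSUP_upper) (auto simp: schwartz_space_def)

lemma schwartz_seminorm_nonneg:
  assumes "g \<in> schwartz_space" "bs \<in> lists Basis"
  shows "0 \<le> schwartz_seminorm k bs g"
  by (rule order_trans[OF _ schwartz_weighted_le_seminorm[OF assms, of _ 0]])
     (simp add: schwartz_weighted_def)

lemma integral_norm_le_seminorm:
  fixes g :: "'a::euclidean_space \<Rightarrow> complex"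
  assumes g: "g \<in> schwartz_space" and bs: "bs \<in> lists Basis" and N: "2 * DIM('a) \<le> N"
  shows "(\<integral>x. norm (foldr partial_deriv bs g x) \<partial>lborel) \<le>
    schwartz_seminorm N bs g * (\<integral>x. 1 / (1 + norm (x::'a)) ^ (2 * DIM('a)) \<partial>lborel)"
proof (rule rapidly_decreasing_integrable_norm(2))
  show "foldr partial_deriv bs g \<in> borel_measurable borel"
    by (intro schwartz_space_measurable foldr_partial_deriv_schwartz_space g bs)
  show "(1 + norm x) ^ (2 * DIM('a)) * norm (foldr partial_deriv bs g x) \<le> schwartz_seminorm N bs g" for x
    using schwartz_weighted_le_seminorm[OF g bs, of N x]
    by (rule order_trans[rotated]) (auto simp: schwartz_weighted_def intro!: mult_right_mono power_increasing N)
qed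

text \<open>The continuity estimate for the distribution built in
  \<open>has_fourier_fun_exists\<close>. There the transform is only integrated against a function,
  so a weighted bound on the transform itself suffices, without bounds on its derivatives.\<close>

lemma fourier_continuous:
  "\<exists>N C. 0 \<le> C \<and> (\<forall>g\<in>schwartz_space. \<forall>\<xi>::'a::euclidean_space. (1 + norm \<xi>) ^ k * norm (fourier g \<xi>) \<le>
    C * (\<Sum>bs | bs \<in> lists Basis \<and> length bs \<le> N. schwartz_seminorm N bs g))"
proof -
  \<comment> \<open>\<open>k\<close> admits the lists \<open>replicate k b\<close>;
    \<open>2 * DIM('a)\<close> lets the seminorms dominate L1 norms. The factor
    \<open>DIM('a) + 1\<close> multiplying \<open>J\<close> below counts \<open>g\<close> together
    with its k-fold derivative in each direction.\<close>
  define N where "N = max k (2 * DIM('a))"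
  define J where "J = (\<integral>x. 1 / (1 + norm (x::'a)) ^ (2 * DIM('a)) \<partial>lborel)"
  have J: "0 \<le> J" unfolding J_def by (intro Bochner_Integration.integral_nonneg) auto
  let ?L = "{bs. bs \<in> lists (Basis::'a set) \<and> length bs \<le> N}"
  have fin: "finite ?L" using finite_lists_length_le[of "Basis::'a set" N] by (simp add: lists_eq_set)
  have "(1 + norm \<xi>) ^ k * norm (fourier g \<xi>) \<le>
      (real (DIM('a) + 1) ^ k * (real (DIM('a) + 1) * J)) * (\<Sum>bs\<in>?L. schwartz_seminorm N bs g)"
    if g: "g \<in> schwartz_space" for g and \<xi> :: 'a
  proof -
    let ?S = "\<Sum>bs\<in>?L. schwartz_seminorm N bs g"
    have *: "(\<integral>x. norm (foldr partial_deriv bs g x) \<partial>lborel) \<le> ?S * J" if "bs \<in> ?L" for bs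
    proof -
      have "schwartz_seminorm N bs g \<le> ?S"
        by (rule member_le_sum[where f="\<lambda>bs. schwartz_seminorm N bs g"])
           (use that fin in \<open>auto intro!: schwartz_seminorm_nonneg[OF g]\<close>)
      then have "schwartz_seminorm N bs g * J \<le> ?S * J" using J by (rule mult_right_mono)
      then show ?thesis
        using integral_norm_le_seminorm[OF g, of bs N] that by (auto simp: N_def J_def)
    qed
    have "(1 + norm \<xi>) ^ k * norm (fourier g \<xi>) \<le> real (DIM('a) + 1) ^ k *
      ((\<integral>x. norm (foldr partial_deriv [] g x) \<partial>lborel) +
       (\<Sum>b\<in>Basis. \<integral>x. norm (foldr partial_deriv (replicate k b) g x) \<partial>lborel))"
      using fourier_weighted_le[OF g] by simp
    also have "\<dots> \<le> real (DIM('a) + 1) ^ k * (?S * J + (\<Sum>b\<in>(Basis::'a set). ?S * J))"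
      by (intro mult_left_mono add_mono sum_mono *) (auto simp: N_def)
    also have "\<dots> = (real (DIM('a) + 1) ^ k * (real (DIM('a) + 1) * J)) * ?S"
      by (simp add: algebra_simps)
    finally show ?thesis .
  qed
  moreover have "0 \<le> real (DIM('a) + 1) ^ k * (real (DIM('a) + 1) * J)" using J by simp
  ultimately show ?thesis by blast
qed

section \<open>Gaussians and Fourier inversion\<close>

text \<open>The linear term covers, up to constants, shifted Gaussians and their products with
  centred ones; these are the test functions of the uniqueness argument.\<close>

lemma exp_quadratic_schwartz_space:
  fixes v :: "'a::euclidean_space"
  assumes p: "0 < p"
  shows "(\<lambda>x. complex_of_real (exp (- (p * (x \<bullet> x)) + x \<bullet> v))) \<in> schwartz_space"
proof -
  define E where "E = (\<lambda>x::'a. complex_of_real (exp (- (p * (x \<bullet> x)) + x \<bullet> v)))"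
  have D: "(E has_derivative (\<lambda>h. complex_of_real (x \<bullet> (- (2 * p) *\<^sub>R h)) * E x + complex_of_real (h \<bullet> v) * E x)) (at x)" for x
    unfolding E_def
    by (auto intro!: derivative_eq_intros simp: algebra_simps inner_commute)
  have "schwartz_span {E} \<subseteq> schwartz_space"
  proof (rule schwartz_span_subset; simp)
    show "E differentiable_on UNIV"
      using D by (auto simp: differentiable_on_def differentiable_def)
    show "rapidly_decreasing E"
      unfolding rapidly_decreasing_def
    proof (intro allI exI)
      fix k and x :: 'a
      let ?m = "real k + norm v"
      have "(1 + norm x) ^ k \<le> exp (norm x) ^ k"
        by (intro power_mono) (auto simp: exp_ge_add_one_self)
      also have "\<dots> = exp (k * norm x)" by (simp add: exp_of_nat_mult)
      finally have "(1 + norm x) ^ k * norm (E x) \<le> exp (k * norm x) * exp (- (p * (x \<bullet> x)) + x \<bullet> v)"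
        by (simp add: E_def)
      also have "\<dots> = exp (k * norm x - p * (norm x)\<^sup>2 + x \<bullet> v)"
        by (simp add: exp_add[symmetric] power2_norm_eq_inner)
      \<comment> \<open>Completing the square: the linear rate \<open>?m\<close> against the
        quadratic decay peaks at \<open>?m\<^sup>2 / (4 * p)\<close>.\<close>
      also have "\<dots> \<le> exp (?m\<^sup>2 / (4 * p))"
      proof -
        have "x \<bullet> v \<le> norm x * norm v" by (rule norm_cauchy_schwarz)
        moreover have "0 \<le> (2 * p * norm x - ?m)\<^sup>2 / (4 * p)" using p by simp
        moreover have "(2 * p * norm x - ?m)\<^sup>2 / (4 * p) = p * (norm x)\<^sup>2 - ?m * norm x + ?m\<^sup>2 / (4 * p)"
          using p by (simp add: field_simps power2_eq_square)
        ultimately show ?thesis by (simp add: algebra_simps)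
      qed
      finally show "(1 + norm x) ^ k * norm (E x) \<le> exp (?m\<^sup>2 / (4 * p))" .
    qed
    fix b :: 'a
    have "partial_deriv b E = (\<lambda>x. complex_of_real (x \<bullet> (- (2 * p) *\<^sub>R b)) * E x + complex_of_real (b \<bullet> v) * E x)"
      by (intro ext partial_deriv_eq D)
    then show "partial_deriv b E \<in> schwartz_span {E}"
      by (simp only:) (intro schwartz_span.add schwartz_span.cmult schwartz_span.coord schwartz_span.base singletonI)
  qed
  then show ?thesis unfolding E_def[symmetric] by (auto intro: schwartz_span.base)
qed

lemma integrable_mult_pair:
  fixes f :: "'a::euclidean_space \<Rightarrow> complex" and k :: "'b::euclidean_space \<Rightarrow> complex"
  assumes f: "integrable lborel f" and k: "integrable lborel k"
  shows "integrable (lborel \<Otimes>\<^sub>M lborel) (\<lambda>(x, y). f x * k y)"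
proof (rule lborel_pair.Fubini_integrable)
  have [measurable]: "f \<in> borel_measurable borel" "k \<in> borel_measurable borel" using f k by auto
  show "(\<lambda>(x, y). f x * k y) \<in> borel_measurable (lborel \<Otimes>\<^sub>M lborel)" by measurable
qed (use f k in \<open>auto simp: norm_mult\<close>)

text \<open>Fubini, since the kernel is symmetric in its two variables. It serves inversion and the
  identification of the distributional transform of an integrable function with the pointwise
  one.\<close>

lemma integral_fourier_mult:
  fixes f k :: "'a::euclidean_space \<Rightarrow> complex"
  assumes f: "integrable lborel f" and k: "integrable lborel k"
  shows "(\<integral>\<xi>. fourier f \<xi> * k \<xi> \<partial>lborel) = (\<integral>x. f x * fourier k x \<partial>lborel)"
proof -
  have [measurable]: "f \<in> borel_measurable borel" "k \<in> borel_measurable borel" using f k by auto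
  let ?e = "\<lambda>x y. exp (- (\<i> * complex_of_real (x \<bullet> y)))"
  have E: "integrable (lborel \<Otimes>\<^sub>M lborel) (\<lambda>(x, y). ?e x y * (f x * k y))"
    by (rule Bochner_Integration.integrable_bound[OF integrable_mult_pair[OF f k]])
       (auto simp: norm_mult split_beta')
  have "(\<integral>\<xi>. fourier f \<xi> * k \<xi> \<partial>lborel) = (\<integral>\<xi>. (\<integral>x. ?e x \<xi> * (f x * k \<xi>) \<partial>lborel) \<partial>lborel)"
    unfolding fourier_def by (simp flip: integral_mult_left_zero mult.assoc)
  also have "\<dots> = (\<integral>x. (\<integral>\<xi>. ?e x \<xi> * (f x * k \<xi>) \<partial>lborel) \<partial>lborel)"
    by (rule lborel_pair.Fubini_integral[OF E])
  also have "\<dots> = (\<integral>x. f x * fourier k x \<partial>lborel)"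
    unfolding fourier_def
    by (simp add: inner_commute mult.left_commute flip: integral_mult_right_zero)
  finally show ?thesis .
qed

lemma lborel_integral_affine:
  fixes h :: "'a::euclidean_space \<Rightarrow> complex"
  assumes [measurable]: "h \<in> borel_measurable borel" and t: "0 < t"
  shows "(\<integral>y. h y \<partial>lborel) = complex_of_real (t ^ DIM('a)) * (\<integral>z. h (x + t *\<^sub>R z) \<partial>lborel)"
proof -
  have "(\<integral>y. h y \<partial>lborel) = (\<integral>y. h y \<partial>density (distr lborel borel (\<lambda>z. x + t *\<^sub>R z)) (\<lambda>_. ennreal (\<bar>t\<bar> ^ DIM('a))))"
    using t by (subst lborel_affine[of t x]) auto
  also have "\<dots> = (\<integral>y. \<bar>t\<bar> ^ DIM('a) *\<^sub>R h y \<partial>distr lborel borel (\<lambda>z. x + t *\<^sub>R z))"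
    by (rule integral_density) auto
  also have "\<dots> = (\<integral>z. \<bar>t\<bar> ^ DIM('a) *\<^sub>R h (x + t *\<^sub>R z) \<partial>lborel)"
    by (rule integral_distr) auto
  finally show ?thesis using t by (simp add: scaleR_conv_of_real)
qed

text \<open>With this variance the Gaussian is an eigenfunction of \<open>fourier\<close>; the
  eigenvalue \<open>gauss_const\<close>, which is also its total mass, is (2 pi)^(n/2).\<close>

definition gauss :: "'a::euclidean_space \<Rightarrow> real" where
  "gauss x = exp (- (x \<bullet> x) / 2)"

definition gauss_const :: "'a::euclidean_space itself \<Rightarrow> real" where
  "gauss_const _ = sqrt (2 * pi) ^ DIM('a)"

lemma gauss_eq_prod:
  "gauss (x::'a::euclidean_space) = gauss_const TYPE('a) * (\<Prod>b\<in>Basis. std_normal_density (x \<bullet> b))"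
proof -
  have "x \<bullet> x = (\<Sum>b\<in>Basis. (x \<bullet> b)\<^sup>2)"
    by (subst euclidean_inner) (simp add: power2_eq_square)
  then have "gauss x = exp (\<Sum>b\<in>Basis. - (x \<bullet> b)\<^sup>2 / 2)"
    by (simp add: gauss_def sum_negf sum_divide_distrib)
  then show ?thesis
    by (simp add: gauss_const_def std_normal_density_def prod_dividef exp_sum prod.distrib)
qed

text \<open>The transform factors over the coordinates, and each factor is the characteristic
  function of the standard normal distribution; that function has the opposite sign in the exponent,
  hence the argument \<open>- t \<bullet> b\<close>.\<close>

lemma
  fixes t :: "'a::euclidean_space"
  shows gauss_integrable: "integrable lborel (\<lambda>x::'a. complex_of_real (gauss x))"
    and fourier_gauss: "fourier (\<lambda>x. complex_of_real (gauss x)) t =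
      complex_of_real (gauss_const TYPE('a) * gauss t)"
proof -
  let ?N = "std_normal_density"
  let ?f = "\<lambda>b s. exp (\<i> * complex_of_real (s * (- t \<bullet> b))) * complex_of_real (?N s)"
  have N: "integrable lborel (\<lambda>s. complex_of_real (?N s))"
    using integrable_std_normal_moment[of 0] by (simp add: complex_of_real_integrable_eq)
  have "integrable lborel (\<lambda>x::'a. \<Prod>b\<in>Basis. complex_of_real (?N (x \<bullet> b)))"
    using N by (rule lborel_integrable_prod(1))
  then show 1: "integrable lborel (\<lambda>x::'a. complex_of_real (gauss x))"
    unfolding gauss_eq_prod by simp
  have f: "integrable lborel (?f b)" for b
    by (rule Bochner_Integration.integrable_bound[OF N]) (auto simp: norm_mult)
  have e: "(\<Prod>b\<in>Basis. ?f b (x \<bullet> b)) = exp (- (\<i> * complex_of_real (x \<bullet> t))) * (\<Prod>b\<in>Basis. complex_of_real (?N (x \<bullet> b)))" for x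
  proof -
    have "- (\<i> * complex_of_real (x \<bullet> t)) = (\<Sum>b\<in>Basis. \<i> * complex_of_real ((x \<bullet> b) * (- t \<bullet> b)))"
      by (subst euclidean_inner) (simp add: sum_negf sum_distrib_left)
    then show ?thesis by (simp only: exp_sum[OF finite_Basis] prod.distrib)
  qed
  have c: "(\<integral>s. ?f b s \<partial>lborel) = complex_of_real (exp (- (t \<bullet> b)\<^sup>2 / 2))" for b
  proof -
    have "char std_normal_distribution (- t \<bullet> b) = (\<integral>s. ?N s *\<^sub>R exp (\<i> * complex_of_real (- t \<bullet> b * s)) \<partial>lborel)"
      unfolding char_def by (subst integral_density) auto
    then show ?thesis
      by (simp add: char_std_normal_distribution scaleR_conv_of_real mult.commute)
  qed
  have "fourier (\<lambda>x. complex_of_real (gauss x)) t =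
      complex_of_real (gauss_const TYPE('a)) * (\<integral>x. (\<Prod>b\<in>(Basis::'a set). ?f b (x \<bullet> b)) \<partial>lborel)"
    unfolding fourier_def gauss_eq_prod e
    by (simp add: mult.left_commute flip: integral_mult_right_zero)
  also have "(\<integral>x. (\<Prod>b\<in>(Basis::'a set). ?f b (x \<bullet> b)) \<partial>lborel) = (\<Prod>b\<in>Basis. \<integral>s. ?f b s \<partial>lborel)"
    using f by (rule lborel_integrable_prod(2))
  also have "\<dots> = complex_of_real (gauss t)"
  proof -
    have "t \<bullet> t = (\<Sum>b\<in>Basis. (t \<bullet> b)\<^sup>2)"
      by (subst euclidean_inner) (simp add: power2_eq_square)
    then have "gauss t = exp (\<Sum>b\<in>Basis. - (t \<bullet> b)\<^sup>2 / 2)"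
      by (simp add: gauss_def sum_negf sum_divide_distrib)
    then show ?thesis unfolding c by (simp add: exp_sum)
  qed
  finally show "fourier (\<lambda>x. complex_of_real (gauss x)) t = complex_of_real (gauss_const TYPE('a) * gauss t)"
    by simp
qed

lemma gauss_measurable [measurable]: "gauss \<in> borel_measurable borel"
  unfolding gauss_def[abs_def] by measurable

text \<open>Convolution with a narrow Gaussian, rescaled: moving the scale into the argument of the
  function leaves a fixed dominating Gaussian. The weight is not normalised, so its mass remains as
  a factor.\<close>

lemma gauss_approximation:
  fixes \<phi> :: "'a::euclidean_space \<Rightarrow> complex"
  assumes \<phi>: "continuous_on UNIV \<phi>" and B: "\<And>x. norm (\<phi> x) \<le> B"
  shows "(\<lambda>n. \<integral>z. \<phi> (x + inverse (real (Suc n)) *\<^sub>R z) * complex_of_real (gauss z) \<partial>lborel)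
    \<longlonglongrightarrow> complex_of_real (gauss_const TYPE('a)) * \<phi> x"
proof -
  let ?t = "\<lambda>n. inverse (real (Suc n))"
  have [measurable]: "\<phi> \<in> borel_measurable borel" by (rule borel_measurable_continuous_onI[OF \<phi>])
  have "(\<lambda>n. \<integral>z. \<phi> (x + ?t n *\<^sub>R z) * complex_of_real (gauss z) \<partial>lborel)
    \<longlonglongrightarrow> (\<integral>z. \<phi> x * complex_of_real (gauss (z::'a)) \<partial>lborel)"
  proof (rule integral_dominated_convergence)
    show "integrable lborel (\<lambda>z::'a. B * gauss z)"
      using gauss_integrable[where 'a='a] by (simp add: complex_of_real_integrable_eq)
    show "AE z in lborel. norm (\<phi> (x + ?t n *\<^sub>R z) * complex_of_real (gauss z)) \<le> B * gauss z" for n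
      using B by (intro AE_I2) (auto simp: norm_mult gauss_def intro!: mult_right_mono)
    show "AE z in lborel. (\<lambda>n. \<phi> (x + ?t n *\<^sub>R z) * complex_of_real (gauss z)) \<longlonglongrightarrow> \<phi> x * complex_of_real (gauss z)"
    proof (intro AE_I2 tendsto_mult_right)
      fix z :: 'a
      have "(\<lambda>n. x + ?t n *\<^sub>R z) \<longlonglongrightarrow> x + 0 *\<^sub>R z"
        by (intro tendsto_intros LIMSEQ_inverse_real_of_nat)
      then show "(\<lambda>n. \<phi> (x + ?t n *\<^sub>R z)) \<longlonglongrightarrow> \<phi> x"
        using continuous_on_tendsto_compose[OF \<phi>, of "\<lambda>n. x + ?t n *\<^sub>R z" x sequentially] by simp
    qed
  qed measurable
  moreover have "(\<integral>z. complex_of_real (gauss (z::'a)) \<partial>lborel) = complex_of_real (gauss_const TYPE('a))"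
    using fourier_gauss[of "0::'a"] by (simp add: fourier_def gauss_def)
  ultimately show ?thesis by (simp add: mult.commute)
qed

text \<open>For small t, a wide Gaussian carrying the phase of x becomes a narrow one centred at x;
  the power of t is the Jacobian of the substitution.\<close>

lemma fourier_modulated_gauss:
  fixes x y :: "'a::euclidean_space"
  assumes t: "0 < t"
  shows "complex_of_real (t ^ DIM('a)) *
      fourier (\<lambda>\<xi>. exp (\<i> * complex_of_real (\<xi> \<bullet> x)) * complex_of_real (gauss (t *\<^sub>R \<xi>))) y =
    complex_of_real (gauss_const TYPE('a) * gauss ((1 / t) *\<^sub>R (y - x)))"
proof -
  let ?h = "\<lambda>\<zeta>. exp (- (\<i> * complex_of_real (\<zeta> \<bullet> ((1 / t) *\<^sub>R (y - x))))) * complex_of_real (gauss \<zeta>)"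
  have "fourier (\<lambda>\<xi>. exp (\<i> * complex_of_real (\<xi> \<bullet> x)) * complex_of_real (gauss (t *\<^sub>R \<xi>))) y =
      (\<integral>\<xi>. ?h (0 + t *\<^sub>R \<xi>) \<partial>lborel)"
    unfolding fourier_def using t
    by (intro Bochner_Integration.integral_cong refl)
       (simp add: inner_diff_right mult.assoc[symmetric] exp_add[symmetric] right_diff_distrib)
  then show ?thesis
    using lborel_integral_affine[of ?h t 0] t fourier_gauss[of "(1 / t) *\<^sub>R (y - x)"]
    by (simp add: fourier_def)
qed

text \<open>The outer integral is regularised by a wide Gaussian;
  \<open>integral_fourier_mult\<close> moves the transform onto that Gaussian and leaves an average
  of \<open>g\<close> near x. One \<open>gauss_const\<close> comes from the transform of the
  Gaussian, the other from its mass, together (2 pi)^n.\<close>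

theorem fourier_inversion:
  fixes g :: "'a::euclidean_space \<Rightarrow> complex"
  assumes g: "g \<in> schwartz_space"
  shows "fourier (fourier g) (- x) = complex_of_real ((2 * pi) ^ DIM('a)) * g x"
proof -
  let ?t = "\<lambda>n. inverse (real (Suc n))"
  let ?c = "complex_of_real (gauss_const TYPE('a))"
  let ?k = "\<lambda>n \<xi>. exp (\<i> * complex_of_real (\<xi> \<bullet> x)) * complex_of_real (gauss (?t n *\<^sub>R \<xi>))"
  have Fg: "fourier g \<in> schwartz_space" by (rule fourier_schwartz_space[OF g])
  have [measurable]: "g \<in> borel_measurable borel" "fourier g \<in> borel_measurable borel"
    by (intro schwartz_space_measurable g Fg)+
  obtain B where B: "\<And>x. norm (g x) \<le> B"
    using schwartz_spaceD(2)[OF g, unfolded rapidly_decreasing_def, rule_format, of 0] by auto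
  have "(\<lambda>n. \<integral>\<xi>. fourier g \<xi> * ?k n \<xi> \<partial>lborel) \<longlonglongrightarrow>
      (\<integral>\<xi>. fourier g \<xi> * (exp (\<i> * complex_of_real (\<xi> \<bullet> x)) * complex_of_real (gauss (0 *\<^sub>R \<xi>))) \<partial>lborel)"
  proof (rule integral_dominated_convergence)
    show "integrable lborel (\<lambda>\<xi>. norm (fourier g \<xi>))"
      by (intro integrable_norm schwartz_space_integrable Fg)
    show "AE \<xi> in lborel. (\<lambda>n. fourier g \<xi> * ?k n \<xi>) \<longlonglongrightarrow>
        fourier g \<xi> * (exp (\<i> * complex_of_real (\<xi> \<bullet> x)) * complex_of_real (gauss (0 *\<^sub>R \<xi>)))"
      unfolding gauss_def by (intro AE_I2 tendsto_intros LIMSEQ_inverse_real_of_nat) auto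
    show "AE \<xi> in lborel. norm (fourier g \<xi> * ?k n \<xi>) \<le> norm (fourier g \<xi>)" for n
      by (intro AE_I2) (auto simp: norm_mult gauss_def intro!: mult_left_le)
  qed measurable
  also have "(\<integral>\<xi>. fourier g \<xi> * (exp (\<i> * complex_of_real (\<xi> \<bullet> x)) * complex_of_real (gauss (0 *\<^sub>R \<xi>))) \<partial>lborel)
      = fourier (fourier g) (- x)"
    by (simp add: fourier_def[of "fourier g"] gauss_def mult.commute)
  also have "(\<lambda>n. \<integral>\<xi>. fourier g \<xi> * ?k n \<xi> \<partial>lborel) =
      (\<lambda>n. ?c * (\<integral>z. g (x + ?t n *\<^sub>R z) * complex_of_real (gauss z) \<partial>lborel))"
  proof
    fix n
    let ?T = "complex_of_real (?t n ^ DIM('a))"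
    have "?t n *\<^sub>R \<xi> \<bullet> ?t n *\<^sub>R \<xi> = (?t n)\<^sup>2 * (\<xi> \<bullet> \<xi>)" for \<xi> :: 'a
      by (simp only: inner_scaleR_left inner_scaleR_right power2_eq_square mult.assoc)
    then have "complex_of_real (gauss (?t n *\<^sub>R \<xi>)) =
        complex_of_real (exp (- ((?t n)\<^sup>2 / 2 * (\<xi> \<bullet> \<xi>)) + \<xi> \<bullet> 0))" for \<xi> :: 'a
      by (simp add: gauss_def)
    then have w: "integrable lborel (\<lambda>\<xi>::'a. complex_of_real (gauss (?t n *\<^sub>R \<xi>)))"
      by (simp only:) (intro schwartz_space_integrable exp_quadratic_schwartz_space, simp)
    have "integrable lborel (?k n)"
      by (rule Bochner_Integration.integrable_bound[OF w]) (auto simp: norm_mult)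
    then have "?T * (\<integral>\<xi>. fourier g \<xi> * ?k n \<xi> \<partial>lborel) = (\<integral>y. g y * (?T * fourier (?k n) y) \<partial>lborel)"
      by (simp add: integral_fourier_mult schwartz_space_integrable g mult.left_commute
          flip: integral_mult_right_zero)
    also have "\<dots> = ?c * (\<integral>y. g y * complex_of_real (gauss ((1 / ?t n) *\<^sub>R (y - x))) \<partial>lborel)"
      by (subst fourier_modulated_gauss) (simp_all add: mult.left_commute flip: integral_mult_right_zero)
    also have "\<dots> = ?c * (?T * (\<integral>z. g (x + ?t n *\<^sub>R z) * complex_of_real (gauss z) \<partial>lborel))"
      by (subst lborel_integral_affine[where t="?t n" and x=x]) simp_all
    finally have eq: "?T * (\<integral>\<xi>. fourier g \<xi> * ?k n \<xi> \<partial>lborel) =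
        ?T * (?c * (\<integral>z. g (x + ?t n *\<^sub>R z) * complex_of_real (gauss z) \<partial>lborel))"
      by (simp only: mult.left_commute)
    have ne: "?T \<noteq> 0" by (simp del: of_nat_Suc)
    show "(\<integral>\<xi>. fourier g \<xi> * ?k n \<xi> \<partial>lborel) =
        ?c * (\<integral>z. g (x + ?t n *\<^sub>R z) * complex_of_real (gauss z) \<partial>lborel)"
      using eq unfolding mult_left_cancel[OF ne] .
  qed
  finally have "(\<lambda>n. ?c * (\<integral>z. g (x + ?t n *\<^sub>R z) * complex_of_real (gauss z) \<partial>lborel)) \<longlonglongrightarrow> fourier (fourier g) (- x)" .
  moreover have "(\<lambda>n. ?c * (\<integral>z. g (x + ?t n *\<^sub>R z) * complex_of_real (gauss z) \<partial>lborel)) \<longlonglongrightarrow> ?c * (?c * g x)"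
    by (intro tendsto_mult_left gauss_approximation[OF schwartz_space_continuous[OF g] B])
  ultimately have "fourier (fourier g) (- x) = ?c * (?c * g x)" by (rule LIMSEQ_unique)
  also have "\<dots> = complex_of_real (gauss_const TYPE('a) * gauss_const TYPE('a)) * g x" by simp
  also have "gauss_const TYPE('a) * gauss_const TYPE('a) = (2 * pi) ^ DIM('a)"
    unfolding gauss_const_def power_mult_distrib[of "sqrt (2 * pi)", symmetric] by simp
  finally show ?thesis .
qed

section \<open>Distributions whose Fourier transform is a function\<close>

lemma has_fourier_fun_integral:
  assumes "has_fourier_fun T F" "g \<in> schwartz_space"
  shows "T (fourier g) = (\<integral>\<xi>. F \<xi> * g \<xi> \<partial>lborel)"
proof -
  have "dist_fourier T g = fun_dist F g" using assms by (simp add: has_fourier_fun_def)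
  then show ?thesis using assms by (simp add: dist_fourier_def fun_dist_def)
qed

text \<open>By inversion the fourth power of the Fourier transform is a scalar.\<close>

lemma fourier_surj:
  fixes g :: "'a::euclidean_space \<Rightarrow> complex"
  assumes g: "g \<in> schwartz_space"
  obtains h where "h \<in> schwartz_space" "g = fourier h"
proof
  let ?c = "complex_of_real ((2 * pi) ^ DIM('a))"
  let ?h = "\<lambda>x. (1 / (?c * ?c)) * fourier (fourier (fourier g)) x"
  show "?h \<in> schwartz_space" by (intro schwartz_space_cmult fourier_schwartz_space g)
  show "g = fourier ?h"
  proof
    fix x
    have "fourier (fourier (fourier (fourier g))) (- (- x)) = ?c * (?c * g x)"
      using fourier_inversion[OF fourier_schwartz_space[OF fourier_schwartz_space[OF g]], of "- x"]
        fourier_inversion[OF g, of x] by simp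
    then show "g x = fourier ?h x" unfolding fourier_cmult by simp
  qed
qed

text \<open>By \<open>fourier_surj\<close> a distribution is determined by its values on transforms,
  and outside the Schwartz space both functionals are undefined. This is the uniqueness half of the
  definite description in \<open>smoothed_vline\<close>.\<close>

lemma has_fourier_fun_unique:
  assumes "has_fourier_fun T F" "has_fourier_fun T' F"
    and "T \<in> extensional schwartz_space" "T' \<in> extensional schwartz_space"
  shows "T = T'"
proof (rule extensionalityI[OF assms(3,4)])
  fix g :: "'a \<Rightarrow> complex" assume "g \<in> schwartz_space"
  then show "T g = T' g"
    using has_fourier_fun_integral[OF assms(1)] has_fourier_fun_integral[OF assms(2)]
    by (metis fourier_surj)
qed

lemma integrable_mult_schwartz_space:
  fixes G :: "'a::euclidean_space \<Rightarrow> complex"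
  assumes [measurable]: "G \<in> borel_measurable borel"
    and G: "integrable lborel (\<lambda>x. norm (G x) / (1 + norm x) ^ k)"
    and g: "g \<in> schwartz_space"
  shows "integrable lborel (\<lambda>x. G x * g x)"
proof -
  have [measurable]: "g \<in> borel_measurable borel" by (rule schwartz_space_measurable[OF g])
  obtain C where C: "\<And>x. (1 + norm x) ^ k * norm (g x) \<le> C"
    using schwartz_spaceD(2)[OF g] unfolding rapidly_decreasing_def by blast
  have C0: "0 \<le> C" using order_trans[OF _ C[of 0]] by simp
  show ?thesis
  proof (rule Bochner_Integration.integrable_bound[OF integrable_mult_right[OF G, of C]])
    show "AE x in lborel. norm (G x * g x) \<le> norm (C * (norm (G x) / (1 + norm x) ^ k))"
    proof (rule AE_I2)
      fix x
      have "norm (G x * g x) \<le> norm (G x) * (C * (1 / (1 + norm x) ^ k))"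
        unfolding norm_mult by (intro mult_left_mono norm_le_weighted C) simp
      also have "\<dots> \<le> norm (C * (norm (G x) / (1 + norm x) ^ k))"
        using C0 by (simp add: abs_mult mult.commute)
      finally show "norm (G x * g x) \<le> norm (C * (norm (G x) / (1 + norm x) ^ k))" .
    qed
  qed measurable
qed

lemma has_fourier_fun_exists:
  fixes G :: "'a::euclidean_space \<Rightarrow> complex"
  assumes [measurable]: "G \<in> borel_measurable borel"
    and G: "integrable lborel (\<lambda>x. norm (G x) / (1 + norm x) ^ k)"
  obtains W where "W \<in> tempered_distributions" "has_fourier_fun W G"
proof
  let ?c = "complex_of_real ((2 * pi) ^ DIM('a))"
  \<comment> \<open>The inverse Fourier transform of \<open>G\<close>, written dually; inversion
    turns its value at \<open>fourier g\<close> into the pairing of \<open>G\<close> with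
    \<open>g\<close>.\<close>
  define W where "W = (\<lambda>g\<in>schwartz_space. 1 / ?c * (\<integral>\<xi>. G \<xi> * fourier g (- \<xi>) \<partial>lborel))"
  note Gg = integrable_mult_schwartz_space[OF assms]
  have i: "integrable lborel (\<lambda>\<xi>. G \<xi> * fourier g (- \<xi>))" if "g \<in> schwartz_space" for g
    by (intro Gg schwartz_space_uminus_arg fourier_schwartz_space that)
  show "W \<in> tempered_distributions"
    unfolding tempered_distributions_def
  proof (intro CollectI conjI ballI allI)
    show "W \<in> extensional schwartz_space" by (simp add: W_def)
    show "W (\<lambda>x. g x + h x) = W g + W h" if g: "g \<in> schwartz_space" and h: "h \<in> schwartz_space" for g h
      using i[OF g] i[OF h]
      by (simp add: W_def schwartz_space_add g h fourier_add schwartz_space_integrable distrib_left add_divide_distrib)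
    show "W (\<lambda>x. c * g x) = c * W g" if g: "g \<in> schwartz_space" for c g
      by (simp add: W_def schwartz_space_cmult g fourier_cmult mult.left_commute)
    obtain N C where C: "0 \<le> C" and
      NC: "\<And>g \<xi>. g \<in> schwartz_space \<Longrightarrow> (1 + norm (\<xi>::'a)) ^ k * norm (fourier g \<xi>) \<le>
        C * (\<Sum>bs | bs \<in> lists Basis \<and> length bs \<le> N. schwartz_seminorm N bs g)"
      using fourier_continuous[of k, where 'a='a] by blast
    define J where "J = (\<integral>x. norm (G x) / (1 + norm x) ^ k \<partial>lborel)"
    have "norm (W g) \<le> (1 / norm ?c * (C * J)) * (\<Sum>bs | bs \<in> lists Basis \<and> length bs \<le> N. schwartz_seminorm N bs g)"
      (is "_ \<le> _ * ?S") if g: "g \<in> schwartz_space" for g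
    proof -
      have "norm (\<integral>\<xi>. G \<xi> * fourier g (- \<xi>) \<partial>lborel) \<le> (\<integral>\<xi>. norm (G \<xi> * fourier g (- \<xi>)) \<partial>lborel)"
        by (rule integral_norm_bound)
      also have "\<dots> \<le> (\<integral>\<xi>. C * ?S * (norm (G \<xi>) / (1 + norm \<xi>) ^ k) \<partial>lborel)"
      proof (intro integral_mono integrable_norm i g integrable_mult_right G)
        fix \<xi> :: 'a
        have "norm (fourier g (- \<xi>)) \<le> C * ?S * (1 / (1 + norm \<xi>) ^ k)"
          using NC[OF g, of "- \<xi>"] by (intro norm_le_weighted) simp
        then show "norm (G \<xi> * fourier g (- \<xi>)) \<le> C * ?S * (norm (G \<xi>) / (1 + norm \<xi>) ^ k)"
          using mult_left_mono[OF _ norm_ge_zero[of "G \<xi>"]] by (fastforce simp: norm_mult mult_ac)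
      qed
      also have "\<dots> = C * ?S * J" unfolding J_def by (rule integral_mult_right_zero)
      finally have "1 / norm ?c * norm (\<integral>\<xi>. G \<xi> * fourier g (- \<xi>) \<partial>lborel) \<le> 1 / norm ?c * (C * ?S * J)"
        by (intro mult_left_mono) auto
      then show ?thesis using g by (simp add: W_def norm_divide norm_mult mult_ac)
    qed
    then show "\<exists>N C. \<forall>g\<in>schwartz_space. norm (W g) \<le>
        C * (\<Sum>bs | bs \<in> lists Basis \<and> length bs \<le> N. schwartz_seminorm N bs g)"
      by blast
  qed
  have "W (fourier g) = (\<integral>\<xi>. G \<xi> * g \<xi> \<partial>lborel)" if g: "g \<in> schwartz_space" for g
    by (simp add: W_def fourier_schwartz_space g fourier_inversion mult.left_commute[of "G _"]
        del: of_real_power of_real_mult)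
  then show "has_fourier_fun W G"
    unfolding has_fourier_fun_def using Gg
    by (auto simp: dist_fourier_def fun_dist_def fun_eq_iff)
qed

section \<open>Uniqueness almost everywhere of the representing function\<close>

text \<open>Here \<open>\<phi>\<close> is approximated by its convolutions with narrow Gaussians; after exchanging the integrals,
  \<open>H\<close> is tested against products of two Gaussians, which are Schwartz functions.\<close>

lemma integral_mult_continuous_eq_0:
  fixes H \<phi> :: "'a::euclidean_space \<Rightarrow> complex"
  assumes Hm [measurable]: "H \<in> borel_measurable borel"
    and Hi: "\<And>g. g \<in> schwartz_space \<Longrightarrow> integrable lborel (\<lambda>x. H x * g x)"
    and H0: "\<And>g. g \<in> schwartz_space \<Longrightarrow> (\<integral>x. H x * g x \<partial>lborel) = 0"
    and \<phi>c: "continuous_on UNIV \<phi>" and B: "\<And>x. norm (\<phi> x) \<le> B" and \<phi>i: "integrable lborel \<phi>"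
  shows "(\<integral>x. H x * complex_of_real (gauss x) * \<phi> x \<partial>lborel) = 0"
proof -
  let ?t = "\<lambda>n. inverse (real (Suc n))"
  let ?c = "complex_of_real (gauss_const TYPE('a))"
  let ?u = "\<lambda>x. H x * complex_of_real (gauss x)"
  let ?a = "\<lambda>n x. \<integral>z. \<phi> (x + ?t n *\<^sub>R z) * complex_of_real (gauss z) \<partial>lborel"
  have [measurable]: "\<phi> \<in> borel_measurable borel" by (rule borel_measurable_continuous_onI[OF \<phi>c])
  have "(\<lambda>x::'a. complex_of_real (gauss x)) = (\<lambda>x. complex_of_real (exp (- (1 / 2 * (x \<bullet> x)) + x \<bullet> 0)))"
    by (simp add: gauss_def)
  then have gS: "(\<lambda>x::'a. complex_of_real (gauss x)) \<in> schwartz_space"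
    using exp_quadratic_schwartz_space[of "1 / 2" "0::'a"] by simp
  have u: "integrable lborel ?u" by (rule Hi[OF gS])
  have K: "(\<integral>x. ?u x * complex_of_real (gauss ((1 / t) *\<^sub>R (y - x))) \<partial>lborel) = 0" for t :: real and y
  proof -
    \<comment> \<open>\<open>d\<close> and \<open>p\<close> collect the constant and the quadratic
      coefficient of the sum of the two Gaussian exponents. The identity survives t = 0, where
      division by zero gives 0 and both sides reduce to \<open>gauss x\<close>.\<close>
    define d where "d = complex_of_real (exp (- (y \<bullet> y) / (2 * t\<^sup>2)))"
    define p where "p = 1 / 2 + 1 / (2 * t\<^sup>2)"
    have p: "0 < p" by (simp add: p_def add_pos_nonneg)
    let ?E = "\<lambda>x. d * complex_of_real (exp (- (p * (x \<bullet> x)) + x \<bullet> ((1 / t\<^sup>2) *\<^sub>R y)))"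
    have E: "?E \<in> schwartz_space" by (intro schwartz_space_cmult exp_quadratic_schwartz_space p)
    have "complex_of_real (gauss x) * complex_of_real (gauss ((1 / t) *\<^sub>R (y - x))) = ?E x" for x
    proof -
      have "- (x \<bullet> x) / 2 + - (((1 / t) *\<^sub>R (y - x)) \<bullet> ((1 / t) *\<^sub>R (y - x))) / 2 =
          - (y \<bullet> y) / (2 * t\<^sup>2) + (- (p * (x \<bullet> x)) + x \<bullet> ((1 / t\<^sup>2) *\<^sub>R y))"
        unfolding p_def
        by (cases "t = 0") (auto simp: inner_diff_left inner_diff_right inner_commute field_simps power2_eq_square)
      then show ?thesis
        unfolding gauss_def d_def of_real_mult[symmetric] exp_add[symmetric] by (simp only:)
    qed
    then show ?thesis using H0[OF E] by (simp only: mult.assoc)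
  qed
  have z: "(\<integral>x. ?u x * ?a n x \<partial>lborel) = 0" for n
  proof -
    let ?T = "complex_of_real (?t n ^ DIM('a))"
    let ?K = "\<lambda>x y. complex_of_real (gauss ((1 / ?t n) *\<^sub>R (y - x)))"
    have T: "?T * ?a n x = (\<integral>y. \<phi> y * ?K x y \<partial>lborel)" for x
      by (subst lborel_integral_affine[where t="?t n" and x=x]) simp_all
    \<comment> \<open>The second Gaussian is at most 1, so integrability on the product space comes
      from \<open>?u\<close> in x and from \<phi> in y.\<close>
    have P: "integrable (lborel \<Otimes>\<^sub>M lborel) (\<lambda>(x, y). ?u x * \<phi> y * ?K x y)"
      by (rule Bochner_Integration.integrable_bound[OF integrable_mult_pair[OF u \<phi>i]])
         (auto simp: norm_mult split_beta' gauss_def intro!: mult_left_le)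
    have "?T * (\<integral>x. ?u x * ?a n x \<partial>lborel) = (\<integral>x. ?u x * (?T * ?a n x) \<partial>lborel)"
      by (simp only: mult.left_commute flip: integral_mult_right_zero)
    also have "\<dots> = (\<integral>x. (\<integral>y. ?u x * \<phi> y * ?K x y \<partial>lborel) \<partial>lborel)"
      unfolding T by (simp only: mult.assoc integral_mult_right_zero)
    also have "\<dots> = (\<integral>y. (\<integral>x. ?u x * \<phi> y * ?K x y \<partial>lborel) \<partial>lborel)"
      by (rule lborel_pair.Fubini_integral[OF P, symmetric])
    also have "\<dots> = (\<integral>y. \<phi> y * (\<integral>x. ?u x * ?K x y \<partial>lborel) \<partial>lborel)"
      by (simp only: mult_ac flip: integral_mult_right_zero)
    also have "\<dots> = 0" unfolding K by simp
    finally have eq: "?T * (\<integral>x. ?u x * ?a n x \<partial>lborel) = ?T * 0" by simp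
    have ne: "?T \<noteq> 0" by (simp del: of_nat_Suc)
    show ?thesis using eq unfolding mult_left_cancel[OF ne] .
  qed
  have "(\<lambda>n. \<integral>x. ?u x * ?a n x \<partial>lborel) \<longlonglongrightarrow> (\<integral>x. ?u x * (?c * \<phi> x) \<partial>lborel)"
  proof (rule integral_dominated_convergence)
    define J where "J = (\<integral>z. norm (complex_of_real (gauss (z::'a))) \<partial>lborel)"
    show "integrable lborel (\<lambda>x. norm (?u x) * (B * J))"
      by (intro integrable_mult_left integrable_norm u)
    show "AE x in lborel. (\<lambda>n. ?u x * ?a n x) \<longlonglongrightarrow> ?u x * (?c * \<phi> x)"
      by (intro AE_I2 tendsto_mult_left gauss_approximation[OF \<phi>c B])
    show "AE x in lborel. norm (?u x * ?a n x) \<le> norm (?u x) * (B * J)" for n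
    proof (rule AE_I2)
      fix x :: 'a
      have "norm (?a n x) \<le> (\<integral>z. norm (\<phi> (x + ?t n *\<^sub>R z) * complex_of_real (gauss z)) \<partial>lborel)"
        by (rule integral_norm_bound)
      also have "\<dots> \<le> (\<integral>z. B * norm (complex_of_real (gauss (z::'a))) \<partial>lborel)"
      proof (rule integral_mono')
        show "integrable lborel (\<lambda>z::'a. B * norm (complex_of_real (gauss z)))"
          by (intro integrable_mult_right integrable_norm gauss_integrable)
        show "norm (\<phi> (x + ?t n *\<^sub>R z) * complex_of_real (gauss z)) \<le> B * norm (complex_of_real (gauss z))" for z
          unfolding norm_mult by (intro mult_right_mono B) simp
        show "0 \<le> B * norm (complex_of_real (gauss z))" for z :: 'a
          using order_trans[OF norm_ge_zero B] by simp
      qed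
      also have "\<dots> = B * J" unfolding J_def by (rule integral_mult_right_zero)
      finally show "norm (?u x * ?a n x) \<le> norm (?u x) * (B * J)"
        unfolding norm_mult[of "?u x"] by (rule mult_left_mono) simp
    qed
  qed measurable
  then have "(\<integral>x. ?u x * (?c * \<phi> x) \<partial>lborel) = 0"
    unfolding z using LIMSEQ_unique tendsto_const by blast
  then have "?c * (\<integral>x. ?u x * \<phi> x \<partial>lborel) = 0"
    by (simp only: mult.left_commute flip: integral_mult_right_zero)
  then show ?thesis by (simp add: gauss_const_def)
qed

text \<open>Dynkin argument: the closed sets generate the Borel sets and are stable under
  intersection, while the sets of vanishing integral are stable under complements, the whole space
  being closed, and under countable disjoint unions.\<close>

lemma AE_eq_0_if_integral_closed_eq_0:
  fixes u :: "'a::euclidean_space \<Rightarrow> complex"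
  assumes u: "integrable lborel u"
    and closed: "\<And>C. closed C \<Longrightarrow> (LINT x:C|lborel. u x) = 0"
  shows "AE x in lborel. u x = 0"
proof (rule sigma_finite_measure.density_zero[OF sigma_finite_lborel u])
  fix A :: "'a set" assume "A \<in> sets lborel"
  then have A: "A \<in> sigma_sets UNIV (Collect closed)"
    by (simp add: borel_eq_closed)
  have st: "Int_stable (Collect (closed :: 'a set \<Rightarrow> bool))"
    by (auto simp: Int_stable_def)
  have sub: "Collect closed \<subseteq> Pow (UNIV :: 'a set)" by simp
  from st sub A show "(LINT x:A|lborel. u x) = 0"
  proof (induction rule: sigma_sets_induct_disjoint)
    case (basic A)
    then show ?case by (simp add: closed)
  next
    case empty
    show ?case by (simp add: set_lebesgue_integral_def)
  next
    case (compl A)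
    then have [measurable]: "A \<in> sets borel" by (simp add: borel_eq_closed)
    have "(LINT x:A \<union> (UNIV - A)|lborel. u x) = (LINT x:A|lborel. u x) + (LINT x:UNIV - A|lborel. u x)"
      using u by (intro set_integral_Un) (auto simp: set_integrable_def intro: integrable_mult_indicator)
    then show ?case using compl closed[of UNIV] by simp
  next
    case (union A)
    have [measurable]: "A i \<in> sets borel" for i using union by (auto simp: borel_eq_closed)
    have "(LINT x:(\<Union>i. A i)|lborel. u x) = (\<Sum>i. LINT x:A i|lborel. u x)"
      using u union by (intro lebesgue_integral_countable_add)
        (auto simp: disjoint_family_on_def set_integrable_def intro: integrable_mult_indicator)
    then show ?case using union by simp
  qed
qed

lemma AE_eq_0_if_integral_schwartz_eq_0:
  fixes H :: "'a::euclidean_space \<Rightarrow> complex"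
  assumes Hm [measurable]: "H \<in> borel_measurable borel"
    and Hi: "\<And>g. g \<in> schwartz_space \<Longrightarrow> integrable lborel (\<lambda>x. H x * g x)"
    and H0: "\<And>g. g \<in> schwartz_space \<Longrightarrow> (\<integral>x. H x * g x \<partial>lborel) = 0"
  shows "AE x in lborel. H x = 0"
proof -
  let ?g = "\<lambda>x::'a. complex_of_real (gauss x)"
  let ?u = "\<lambda>x. H x * ?g x * ?g x"
  have S: "(\<lambda>x. ?g x * ?g x) \<in> schwartz_space"
    using exp_quadratic_schwartz_space[of 1 "0::'a"]
    by (simp add: gauss_def flip: exp_add of_real_mult)
  have u: "integrable lborel ?u" using Hi[OF S] by (simp add: mult.assoc)
  have "AE x in lborel. ?u x = 0"
  proof (rule AE_eq_0_if_integral_closed_eq_0[OF u])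
    fix C :: "'a set" assume C: "closed C"
    show "(LINT x:C|lborel. ?u x) = 0"
    \<comment> \<open>\<open>infdist\<close> to the empty set is 0 by convention, so the
      approximations below would be constantly 1 instead of tending to 0.\<close>
    proof (cases "C = {}")
      case False
      have [measurable]: "C \<in> sets borel" using C by simp
      \<comment> \<open>The base is 1 on \<open>C\<close> and, as \<open>C\<close> is closed, less
        than 1 off it, so the powers tend to the indicator of \<open>C\<close>.\<close>
      let ?p = "\<lambda>n x. complex_of_real ((1 / (1 + infdist x C)) ^ n)"
      have p1: "norm (?p n x) \<le> 1" for n and x :: 'a
        unfolding norm_of_real using infdist_nonneg[of x C] by (auto intro!: power_le_one)
      have pc: "continuous_on UNIV (?p n)" for n
        by (intro continuous_intros) (metis add_nonneg_eq_0_iff infdist_nonneg zero_le_one zero_neq_one)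
      have [measurable]: "?p n \<in> borel_measurable borel" for n
        by (rule borel_measurable_continuous_onI[OF pc])
      have "(\<integral>x. H x * ?g x * (?g x * ?p n x) \<partial>lborel) = 0" for n
      proof (rule integral_mult_continuous_eq_0[OF Hm Hi H0])
        show "continuous_on UNIV (\<lambda>x. ?g x * ?p n x)"
          unfolding gauss_def by (intro continuous_on_mult pc continuous_intros) auto
        show b: "norm (?g x * ?p n x) \<le> 1" for x
          unfolding norm_mult using p1[of x n] by (intro mult_le_one) (auto simp: gauss_def)
        show "integrable lborel (\<lambda>x. ?g x * ?p n x)"
        proof (rule Bochner_Integration.integrable_bound[OF gauss_integrable])
          show "AE x in lborel. norm (?g x * ?p n x) \<le> norm (?g x)"
            unfolding norm_mult by (intro AE_I2 mult_left_le p1) simp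
        qed measurable
      qed
      moreover have "(\<lambda>n. \<integral>x. H x * ?g x * (?g x * ?p n x) \<partial>lborel) \<longlonglongrightarrow> (\<integral>x. indicator C x *\<^sub>R ?u x \<partial>lborel)"
      proof (rule integral_dominated_convergence)
        show "integrable lborel (\<lambda>x. norm (?u x))" by (rule integrable_norm[OF u])
        show "AE x in lborel. norm (H x * ?g x * (?g x * ?p n x)) \<le> norm (?u x)" for n
          unfolding mult.assoc[symmetric] norm_mult[of _ "?p n _"]
          by (intro AE_I2 mult_left_le p1) simp
        show "AE x in lborel. (\<lambda>n. H x * ?g x * (?g x * ?p n x)) \<longlonglongrightarrow> indicator C x *\<^sub>R ?u x"
        proof (rule AE_I2)
          fix x :: 'a
          have "(\<lambda>n. (1 / (1 + infdist x C)) ^ n) \<longlonglongrightarrow> indicator C x"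
          proof (cases "x \<in> C")
            case False
            then have "0 < infdist x C"
              using in_closed_iff_infdist_zero[OF C \<open>C \<noteq> {}\<close>, of x] infdist_nonneg[of x C] by linarith
            then show ?thesis using False by (simp add: LIMSEQ_realpow_zero)
          qed simp
          then have "(\<lambda>n. H x * ?g x * (?g x * ?p n x)) \<longlonglongrightarrow> H x * ?g x * (?g x * complex_of_real (indicator C x))"
            by (intro tendsto_mult_left tendsto_of_real)
          then show "(\<lambda>n. H x * ?g x * (?g x * ?p n x)) \<longlonglongrightarrow> indicator C x *\<^sub>R ?u x"
            by (simp add: scaleR_conv_of_real mult_ac)
        qed
      qed measurable
      ultimately show ?thesis
        unfolding set_lebesgue_integral_def by (simp add: LIMSEQ_const_iff)
    qed (simp add: set_lebesgue_integral_def)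
  qed
  then show ?thesis by (simp add: gauss_def)
qed

lemma has_fourier_fun_AE_unique:
  assumes F: "has_fourier_fun T F" and G: "has_fourier_fun T G"
  shows "AE \<xi> in lborel. F \<xi> = G \<xi>"
proof -
  have i: "integrable lborel (\<lambda>\<xi>. F \<xi> * g \<xi>)" "integrable lborel (\<lambda>\<xi>. G \<xi> * g \<xi>)"
    if "g \<in> schwartz_space" for g
    using F G that by (auto simp: has_fourier_fun_def)
  have "AE \<xi> in lborel. F \<xi> - G \<xi> = 0"
  proof (rule AE_eq_0_if_integral_schwartz_eq_0)
    show "(\<lambda>\<xi>. F \<xi> - G \<xi>) \<in> borel_measurable borel"
      using F G by (auto simp: has_fourier_fun_def)
    show "integrable lborel (\<lambda>\<xi>. (F \<xi> - G \<xi>) * g \<xi>)" if "g \<in> schwartz_space" for g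
      unfolding left_diff_distrib by (intro Bochner_Integration.integrable_diff i that)
    show "(\<integral>\<xi>. (F \<xi> - G \<xi>) * g \<xi> \<partial>lborel) = 0" if "g \<in> schwartz_space" for g
      unfolding left_diff_distrib Bochner_Integration.integral_diff[OF i[OF that]]
      by (simp flip: has_fourier_fun_integral[OF F that] has_fourier_fun_integral[OF G that])
  qed
  then show ?thesis by simp
qed

lemma has_fourier_fun_fourier_fun:
  assumes "has_fourier_fun T F"
  shows "has_fourier_fun T (fourier_fun T)"
  unfolding fourier_fun_def using assms by (rule someI[where P="has_fourier_fun T"])

text \<open>Links the two transforms in play: the kernel enters \<open>smoothed_vline\<close>
  through its pointwise transform, but its Sobolev norm through the distributional one. The
  pointwise transform is bounded, hence integrable against Schwartz functions.\<close>

lemma has_fourier_fun_fun_dist: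
  fixes f :: "'a::euclidean_space \<Rightarrow> complex"
  assumes f: "integrable lborel f"
  shows "has_fourier_fun (fun_dist f) (fourier f)"
proof -
  have [measurable]: "f \<in> borel_measurable borel" using f by auto
  have "integrable lborel (\<lambda>\<xi>::'a. norm (fourier f \<xi>) / (1 + norm \<xi>) ^ (2 * DIM('a)))"
  proof (rule Bochner_Integration.integrable_bound)
    show "integrable lborel (\<lambda>\<xi>::'a. (\<integral>x. norm (f x) \<partial>lborel) * (1 / (1 + norm \<xi>) ^ (2 * DIM('a))))"
      by (intro integrable_mult_right integrable_inverse_power_norm) auto
    show "AE \<xi> in lborel. norm (norm (fourier f \<xi>) / (1 + norm \<xi>) ^ (2 * DIM('a))) \<le>
        norm ((\<integral>x. norm (f x) \<partial>lborel) * (1 / (1 + norm \<xi>) ^ (2 * DIM('a))))"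
      using norm_fourier_le[of f] by (auto intro!: divide_right_mono order_trans[OF _ abs_ge_self])
  qed measurable
  then have "integrable lborel (\<lambda>\<xi>. fourier f \<xi> * g \<xi>)" if "g \<in> schwartz_space" for g
    using that by (intro integrable_mult_schwartz_space) measurable
  then show ?thesis
    unfolding has_fourier_fun_def
    by (auto simp: dist_fourier_def fun_dist_def fourier_schwartz_space fun_eq_iff
        integral_fourier_mult[OF f schwartz_space_integrable])
qed

section \<open>Weighted square integrability and the multiplier estimate\<close>

lemma Lp_norm_2_finite_iff:
  "Lp_norm 2 F < \<infinity> \<longleftrightarrow> (\<integral>\<^sup>+x. ennreal ((norm (F x))\<^sup>2) \<partial>lborel) < \<infinity>"
proof -
  have "norm z powr 2 = (norm z)\<^sup>2" for z :: complex
    by (cases "z = 0") auto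
  then show ?thesis by (auto simp: Lp_norm_def Let_def less_top)
qed

text \<open>Supplies the growth condition of \<open>has_fourier_fun_exists\<close>. The integrand is
  at most u v, with \<open>u\<close> the weighted function and \<open>v\<close> a power of 1 / (1 +
  |\<xi>|), both square integrable; the bound u v \<le> u^2 + v^2 takes the place of
  Cauchy-Schwarz.\<close>

lemma integrable_of_weighted_L2:
  fixes F :: "'a::euclidean_space \<Rightarrow> complex"
  assumes [measurable]: "F \<in> borel_measurable borel"
    and F: "Lp_norm 2 (\<lambda>\<xi>. complex_of_real ((1 + (norm \<xi>)\<^sup>2) powr (s / 2)) * F \<xi>) < \<infinity>"
  obtains k where "integrable lborel (\<lambda>\<xi>. norm (F \<xi>) / (1 + norm \<xi>) ^ k)"
proof
  \<comment> \<open>An integer at least |s|, so that (1 + |\<xi>|)^m absorbs the reciprocal weight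
    for either sign of s.\<close>
  define m where "m = nat \<lceil>\<bar>s\<bar>\<rceil>"
  have m: "\<bar>s\<bar> \<le> real m" unfolding m_def by (rule real_nat_ceiling_ge)
  let ?w = "\<lambda>\<xi>::'a. (1 + (norm \<xi>)\<^sup>2) powr (s / 2)"
  let ?n = "DIM('a)"
  have "integrable lborel (\<lambda>\<xi>. (norm (complex_of_real (?w \<xi>) * F \<xi>))\<^sup>2)"
    using F unfolding Lp_norm_2_finite_iff by (intro integrableI_nonneg) auto
  then have i: "integrable lborel (\<lambda>\<xi>. (norm (complex_of_real (?w \<xi>) * F \<xi>))\<^sup>2 + 1 / (1 + norm \<xi>) ^ (2 * ?n))"
    by (intro Bochner_Integration.integrable_add integrable_inverse_power_norm) auto
  show "integrable lborel (\<lambda>\<xi>. norm (F \<xi>) / (1 + norm \<xi>) ^ (?n + m))"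
  proof (rule Bochner_Integration.integrable_bound[OF i])
    show "AE \<xi> in lborel. norm (norm (F \<xi>) / (1 + norm \<xi>) ^ (?n + m)) \<le>
      norm ((norm (complex_of_real (?w \<xi>) * F \<xi>))\<^sup>2 + 1 / (1 + norm \<xi>) ^ (2 * ?n))"
    proof (rule AE_I2)
      fix \<xi> :: 'a
      let ?r = "1 + norm \<xi>"
      define u where "u = norm (complex_of_real (?w \<xi>) * F \<xi>)"
      define v where "v = 1 / ?r ^ ?n"
      have r: "1 \<le> ?r" by simp
      have "1 / ?w \<xi> = (1 + (norm \<xi>)\<^sup>2) powr (- s / 2)"
        by (simp add: powr_minus_divide)
      also have "\<dots> \<le> (1 + (norm \<xi>)\<^sup>2) powr (real m / 2)"
        using m by (intro powr_mono) auto
      also have "\<dots> \<le> (?r\<^sup>2) powr (real m / 2)"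
        by (intro powr_mono2) (auto simp: power2_sum)
      also have "\<dots> = ?r powr real m"
        using r by (simp add: powr_powr flip: powr_numeral)
      also have "\<dots> = ?r ^ m" using r by (intro powr_realpow) linarith
      finally have w: "1 / ?w \<xi> \<le> ?r ^ m" .
      have "0 < 1 + (norm \<xi>)\<^sup>2" by (intro add_pos_nonneg) auto
      then have wpos: "0 < ?w \<xi>" unfolding powr_gt_zero by simp
      have q: "1 / ?w \<xi> / ?r ^ m \<le> 1"
        using w r by (subst divide_le_eq_1_pos) (auto intro!: zero_less_power simp: add_pos_nonneg)
      have "norm (F \<xi>) / ?r ^ (?n + m) = u * v * (1 / ?w \<xi> / ?r ^ m)"
        using wpos by (simp add: u_def v_def norm_mult power_add)
      also have "\<dots> \<le> u * v * 1"
        using q by (rule mult_left_mono) (simp add: u_def v_def)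
      also have "\<dots> \<le> u\<^sup>2 + v\<^sup>2"
      proof -
        have "0 \<le> u * v" by (simp add: u_def v_def)
        then show ?thesis using sum_squares_bound[of u v] by linarith
      qed
      also have "v\<^sup>2 = 1 / ?r ^ (2 * ?n)"
        by (simp add: v_def power_divide mult.commute flip: power_mult)
      finally show "norm (norm (F \<xi>) / ?r ^ (?n + m)) \<le> norm ((norm (complex_of_real (?w \<xi>) * F \<xi>))\<^sup>2 + 1 / ?r ^ (2 * ?n))"
        by (simp add: u_def)
    qed
  qed measurable
qed

lemma segment_symbol_measurable [measurable]: "segment_symbol \<nu> \<in> borel_measurable borel"
  unfolding segment_symbol_def[abs_def] set_lebesgue_integral_def by measurable

lemma norm_segment_symbol_le:
  assumes "0 < \<nu>"
  shows "norm (segment_symbol \<nu> y) \<le> \<nu>"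
proof -
  have "norm (segment_symbol \<nu> y) \<le> (\<integral>t. norm (indicator {0..\<nu>} t *\<^sub>R exp (\<i> * complex_of_real (t * y))) \<partial>lborel)"
    unfolding segment_symbol_def set_lebesgue_integral_def by (rule integral_norm_bound)
  also have "\<dots> = (\<integral>t. indicator {0..\<nu>} t \<partial>lborel)" by simp
  also have "\<dots> = \<nu>" using assms by simp
  finally show ?thesis .
qed

lemma vline_symbol_measurable [measurable]: "vline_symbol a b \<psi> \<nu> \<phi> \<in> borel_measurable borel"
  unfolding vline_symbol_def[abs_def] by measurable

lemma norm_vline_symbol_le:
  assumes "0 < \<nu>"
  shows "norm (vline_symbol a b \<psi> \<nu> \<phi> \<xi>) \<le> (\<bar>a\<bar> + \<bar>b\<bar>) * \<nu>"
proof -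
  have "norm (vline_symbol a b \<psi> \<nu> \<phi> \<xi>) \<le>
      \<bar>a\<bar> * norm (segment_symbol \<nu> (\<xi> \<bullet> dir1 \<psi> \<phi>)) + \<bar>b\<bar> * norm (segment_symbol \<nu> (\<xi> \<bullet> dir2 \<phi>))"
    unfolding vline_symbol_def by (rule order_trans[OF norm_triangle_ineq]) (simp add: norm_mult)
  also have "\<dots> \<le> \<bar>a\<bar> * \<nu> + \<bar>b\<bar> * \<nu>"
    by (intro add_mono mult_left_mono norm_segment_symbol_le assms) auto
  finally show ?thesis by (simp add: distrib_right)
qed

theorem theorem4p4:
  fixes a b \<psi> \<nu> \<alpha> \<beta> \<phi> :: real
    and \<eta> :: "real^2 \<Rightarrow> real"
    and f :: "(real^2 \<Rightarrow> complex) \<Rightarrow> complex"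
  assumes "2 * \<psi> \<in> {0<..<pi}"
    and "\<nu> > 0"
    and "\<phi> \<in> {-pi..pi}"
    and "integrable lborel \<eta>"
    and "\<And>x. \<eta> x \<ge> 0"
    and "(\<integral>x. \<eta> x \<partial>lborel) = 1"
    and "fun_dist (\<lambda>x. complex_of_real (\<eta> x)) \<in> sobolev_space \<beta> \<infinity>"
    and "f \<in> sobolev_space \<alpha> 2"
  shows "smoothed_vline a b \<psi> \<nu> \<eta> f \<phi> \<in> sobolev_space (\<alpha> + \<beta>) 2"
proof -
  define w where "w = (\<lambda>s (\<xi>::real^2). (1 + (norm \<xi>)\<^sup>2) powr (s / 2))"
  have w0: "0 \<le> w s \<xi>" for s \<xi> by (simp add: w_def)
  have wadd: "w (\<alpha> + \<beta>) \<xi> = w \<alpha> \<xi> * w \<beta> \<xi>" for \<xi>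
    by (simp add: w_def add_divide_distrib powr_add)
  define E where "E = fourier (\<lambda>x. complex_of_real (\<eta> x))"
  define F where "F = fourier_fun f"
  define V where "V = vline_symbol a b \<psi> \<nu> \<phi>"
  define S where "S = (\<bar>a\<bar> + \<bar>b\<bar>) * \<nu>"
  have \<eta>: "integrable lborel (\<lambda>x. complex_of_real (\<eta> x))" using assms(4) by simp
  have F: "has_fourier_fun f F"
    using assms(8) has_fourier_fun_fourier_fun unfolding sobolev_space_def F_def by blast
  have [measurable]: "F \<in> borel_measurable borel" "E \<in> borel_measurable borel" "V \<in> borel_measurable borel"
    using F \<eta> by (auto simp: has_fourier_fun_def E_def V_def intro!: fourier_measurable)
  have E: "has_fourier_fun (fun_dist (\<lambda>x. complex_of_real (\<eta> x))) E"
    unfolding E_def by (rule has_fourier_fun_fun_dist[OF \<eta>])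
  let ?ff = "fourier_fun (fun_dist (\<lambda>x. complex_of_real (\<eta> x)))"
  have "sobolev_norm \<beta> \<infinity> (fun_dist (\<lambda>x. complex_of_real (\<eta> x))) < \<infinity>"
    using assms(7) by (simp add: sobolev_space_def)
  then obtain M where M: "0 \<le> M" "sobolev_norm \<beta> \<infinity> (fun_dist (\<lambda>x. complex_of_real (\<eta> x))) = ennreal M"
    by (cases "sobolev_norm \<beta> \<infinity> (fun_dist (\<lambda>x. complex_of_real (\<eta> x)))") auto
  have "AE \<xi> in lborel. ennreal (norm (complex_of_real (w \<beta> \<xi>) * ?ff \<xi>)) \<le> ennreal M"
    using esssup_AE[of "\<lambda>\<xi>. ennreal (norm (complex_of_real (w \<beta> \<xi>) * ?ff \<xi>))" lborel] M(2)
    by (simp add: sobolev_norm_def Lp_norm_def w_def)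
  \<comment> \<open>The bound so far concerns the representative chosen by
    \<open>fourier_fun\<close>; it passes to the pointwise transform \<open>E\<close> off a null
    set.\<close>
  then have EM: "AE \<xi> in lborel. w \<beta> \<xi> * norm (E \<xi>) \<le> M"
    using has_fourier_fun_AE_unique[OF E has_fourier_fun_fourier_fun[OF E]]
    by eventually_elim (use M(1) w0 in \<open>auto simp: norm_mult\<close>)
  define G where "G = (\<lambda>\<xi>. E \<xi> * F \<xi> * V \<xi>)"
  have [measurable]: "G \<in> borel_measurable borel" unfolding G_def by measurable
  have VS: "norm (V \<xi>) \<le> S" for \<xi>
    unfolding V_def S_def using assms(2) by (rule norm_vline_symbol_le)
  have S0: "0 \<le> S" unfolding S_def using assms(2) by simp
  \<comment> \<open>The weight splits by \<open>wadd\<close>: its \<beta> part is spent on the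
    kernel, its \<alpha> part on f, and the symbol contributes the constant
    \<open>S\<close>.\<close>
  have "AE \<xi> in lborel. norm (complex_of_real (w (\<alpha> + \<beta>) \<xi>) * G \<xi>) \<le> M * S * norm (complex_of_real (w \<alpha> \<xi>) * F \<xi>)"
    using EM
  proof eventually_elim
    case (elim \<xi>)
    have "norm (complex_of_real (w (\<alpha> + \<beta>) \<xi>) * G \<xi>) =
        (w \<beta> \<xi> * norm (E \<xi>)) * norm (V \<xi>) * norm (complex_of_real (w \<alpha> \<xi>) * F \<xi>)"
      by (simp add: wadd G_def norm_mult w0 abs_mult mult_ac)
    also have "\<dots> \<le> M * S * norm (complex_of_real (w \<alpha> \<xi>) * F \<xi>)"
      using elim VS M(1) by (intro mult_right_mono mult_mono) auto
    finally show ?case .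
  qed
  then have "AE \<xi> in lborel. ennreal ((norm (complex_of_real (w (\<alpha> + \<beta>) \<xi>) * G \<xi>))\<^sup>2) \<le>
      ennreal ((M * S)\<^sup>2) * ennreal ((norm (complex_of_real (w \<alpha> \<xi>) * F \<xi>))\<^sup>2)"
    by eventually_elim (simp add: power_mono flip: ennreal_mult power_mult_distrib)
  then have "(\<integral>\<^sup>+\<xi>. ennreal ((norm (complex_of_real (w (\<alpha> + \<beta>) \<xi>) * G \<xi>))\<^sup>2) \<partial>lborel) \<le>
      (\<integral>\<^sup>+\<xi>. ennreal ((M * S)\<^sup>2) * ennreal ((norm (complex_of_real (w \<alpha> \<xi>) * F \<xi>))\<^sup>2) \<partial>lborel)"
    by (rule nn_integral_mono_AE)
  also have "\<dots> = ennreal ((M * S)\<^sup>2) * (\<integral>\<^sup>+\<xi>. ennreal ((norm (complex_of_real (w \<alpha> \<xi>) * F \<xi>))\<^sup>2) \<partial>lborel)"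
    unfolding w_def by (intro nn_integral_cmult) measurable
  also have "\<dots> < \<infinity>"
  proof -
    have "Lp_norm 2 (\<lambda>\<xi>. complex_of_real (w \<alpha> \<xi>) * F \<xi>) < \<infinity>"
      using assms(8) by (simp add: sobolev_space_def sobolev_norm_def F_def w_def)
    then show ?thesis unfolding Lp_norm_2_finite_iff by (simp add: ennreal_mult_less_top)
  qed
  finally have GL: "Lp_norm 2 (\<lambda>\<xi>. complex_of_real (w (\<alpha> + \<beta>) \<xi>) * G \<xi>) < \<infinity>"
    unfolding Lp_norm_2_finite_iff .
  \<comment> \<open>The norm estimate for \<open>G\<close> precedes the existence of
    \<open>W\<close>: it is what shows that \<open>G\<close> is the transform of a tempered
    distribution at all.\<close>
  obtain k where "integrable lborel (\<lambda>\<xi>. norm (G \<xi>) / (1 + norm \<xi>) ^ k)"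
    using integrable_of_weighted_L2[of G "\<alpha> + \<beta>"] GL unfolding w_def by auto
  then obtain W where W: "W \<in> tempered_distributions" "has_fourier_fun W G"
    using has_fourier_fun_exists[of G k] by auto
  have "smoothed_vline a b \<psi> \<nu> \<eta> f \<phi> = W"
    unfolding smoothed_vline_def
  proof (rule the_equality)
    fix W' assume "W' \<in> tempered_distributions \<and> has_fourier_fun W'
        (\<lambda>\<xi>. fourier (\<lambda>x. complex_of_real (\<eta> x)) \<xi> * fourier_fun f \<xi> * vline_symbol a b \<psi> \<nu> \<phi> \<xi>)"
    then show "W' = W"
      using W by (intro has_fourier_fun_unique[of W' G W])
        (auto simp: G_def E_def F_def V_def tempered_distributions_def)
  qed (use W in \<open>simp add: G_def E_def F_def V_def\<close>)
  \<comment> \<open>The norm sees only the chosen representative of the transform of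
    \<open>W\<close>, which equals \<open>G\<close> off a null set.\<close>
  moreover have "Lp_norm 2 (\<lambda>\<xi>. complex_of_real (w (\<alpha> + \<beta>) \<xi>) * fourier_fun W \<xi>) < \<infinity>"
  proof -
    have "AE \<xi> in lborel. fourier_fun W \<xi> = G \<xi>"
      by (rule has_fourier_fun_AE_unique[OF has_fourier_fun_fourier_fun[OF W(2)] W(2)])
    then have "(\<integral>\<^sup>+\<xi>. ennreal ((norm (complex_of_real (w (\<alpha> + \<beta>) \<xi>) * fourier_fun W \<xi>))\<^sup>2) \<partial>lborel) =
        (\<integral>\<^sup>+\<xi>. ennreal ((norm (complex_of_real (w (\<alpha> + \<beta>) \<xi>) * G \<xi>))\<^sup>2) \<partial>lborel)"
      by (intro nn_integral_cong_AE) auto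
    then show ?thesis using GL unfolding Lp_norm_2_finite_iff by simp
  qed
  ultimately show ?thesis
    using W by (auto simp: sobolev_space_def sobolev_norm_def w_def)
qed

end
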